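(* Let $k$ be a non-positive integer and let $d$ be a positive integer with $d>-2k+2$. Let $Q_d:=(-\pi,\pi)^d$ and let $\psi\in C^\infty(\overline{Q_d})$ be a complex-valued function all of whose derivatives (including $\psi$ itself) are $2\pi$-periodic in each variable, and which has zero average, $\int_{Q_d}\psi\,dx=0$. Then $$H(k,d)\int_{Q_d}|\psi(x)|^2\,\omega(x)^{k-1}\,dx\;\le\;\int_{Q_d}|\nabla\psi(x)|^2\,\omega(x)^{k}\,dx,$$ where $\omega(x):=\sum_{j=1}^d\sin^2(x_j/2)$, $$H(k,d)^{-1}:=\sum_{j=0}^{-k}d^{\,j}\,C_1(k+j,d)\prod_{i=0}^{j-1}C_2(k+i,d)\;+\;d^{-k}\prod_{i=0}^{-k}C_2(k+i,d),$$ $$C_1(k,d):=\frac{16}{(d+2k-2)^2},\qquad C_2(k,d):=\frac{3d+2k-2}{d(d+2k-2)} .$$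
   Context: A function $\psi:\overline{Q_d}\to\mathbb{C}$ is $2\pi$-periodic in each variable if $\psi(x_1,\dots,x_{i-1},-\pi,x_{i+1},\dots,x_d)=\psi(x_1,\dots,x_{i-1},\pi,x_{i+1},\dots,x_d)$ for all $1\le i\le d$. Empty products equal $1$. *)

theory Defs
  imports "HOL-Analysis.Analysis"
begin

definition Q :: "(real ^ 'n) set" where
  "Q = box (\<chi> i. - pi) (\<chi> i. pi)"

definition partial_deriv :: "'n \<Rightarrow> (real ^ 'n \<Rightarrow> complex) \<Rightarrow> real ^ 'n \<Rightarrow> complex" where
  "partial_deriv i f x = vector_derivative (\<lambda>t. f (x + t *\<^sub>R axis i 1)) (at 0)"

primrec iter_partial_deriv :: "'n list \<Rightarrow> (real ^ 'n \<Rightarrow> complex) \<Rightarrow> real ^ 'n \<Rightarrow> complex" where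
  "iter_partial_deriv [] f = f"
| "iter_partial_deriv (i # js) f = partial_deriv i (iter_partial_deriv js f)"

definition continuous_extension :: "(real ^ 'n) set \<Rightarrow> (real ^ 'n \<Rightarrow> complex) \<Rightarrow> (real ^ 'n \<Rightarrow> complex) \<Rightarrow> bool" where
  "continuous_extension S f g \<longleftrightarrow> continuous_on (closure S) g \<and> (\<forall>x\<in>S. g x = f x)"

text \<open>The space of smooth functions up to the boundary of an open set \<open>S\<close>: all iterated partial
  derivatives exist in \<open>S\<close> and extend continuously to the closure. Functions are total; only the
  values on \<open>closure S\<close> matter (\<open>S\<close> being open, derivatives at points of \<open>S\<close> do not see values
  outside \<open>S\<close>). Continuity of the (continuously extended) partial derivatives of every order makes
  this the usual notion, although each derivative is only required to exist directionally.\<close>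

definition smooth_closure :: "(real ^ 'n) set \<Rightarrow> (real ^ 'n \<Rightarrow> complex) \<Rightarrow> bool" where
  "smooth_closure S f \<longleftrightarrow>
     continuous_on (closure S) f \<and>
     (\<forall>js i. \<forall>x\<in>S. (\<lambda>t. iter_partial_deriv js f (x + t *\<^sub>R axis i 1)) differentiable (at 0)) \<and>
     (\<forall>js. \<exists>g. continuous_extension S (iter_partial_deriv js f) g)"

definition periodic_Q :: "(real ^ 'n \<Rightarrow> complex) \<Rightarrow> bool" where
  "periodic_Q f \<longleftrightarrow>
     (\<forall>i. \<forall>x\<in>closure Q. f (\<chi> j. if j = i then - pi else x $ j) = f (\<chi> j. if j = i then pi else x $ j))"

text \<open>On the boundary of the cube the derivatives are understood as the (unique) continuous
  extensions from \<open>Q\<close>, whose existence is part of \<^const>\<open>smooth_closure\<close>.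
  The empty list of directions gives the periodicity of \<open>f\<close> itself.\<close>

definition all_derivs_periodic :: "(real ^ 'n \<Rightarrow> complex) \<Rightarrow> bool" where
  "all_derivs_periodic f \<longleftrightarrow>
     (\<forall>js g. continuous_extension Q (iter_partial_deriv js f) g \<longrightarrow> periodic_Q g)"

definition grad_norm_sq :: "(real ^ 'n \<Rightarrow> complex) \<Rightarrow> real ^ 'n \<Rightarrow> real" where
  "grad_norm_sq f x = (\<Sum>i\<in>UNIV. (cmod (partial_deriv i f x))\<^sup>2)"

definition \<omega> :: "real ^ 'n \<Rightarrow> real" where
  "\<omega> x = (\<Sum>j\<in>UNIV. (sin (x $ j / 2))\<^sup>2)"

definition C1 :: "int \<Rightarrow> nat \<Rightarrow> real" where
  "C1 k d = 16 / (real d + 2 * of_int k - 2)\<^sup>2"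

definition C2 :: "int \<Rightarrow> nat \<Rightarrow> real" where
  "C2 k d = (3 * real d + 2 * of_int k - 2) / (real d * (real d + 2 * of_int k - 2))"

text \<open>Only used for \<open>k \<le> 0\<close>, where \<open>nat (- k)\<close> is \<open>- k\<close>.\<close>

definition H :: "int \<Rightarrow> nat \<Rightarrow> real" where
  "H k d = inverse
     ((\<Sum>j = 0..nat (- k). real d ^ j * C1 (k + int j) d * (\<Prod>i<j. C2 (k + int i) d))
      + real d ^ nat (- k) * (\<Prod>i = 0..nat (- k). C2 (k + int i) d))"

end

theory Submission
  imports Defs
begin

text \<open>Put \<open>A\<^sub>p = \<integral> |\<psi>|\<^sup>2 \<omega>\<^sup>-\<^sup>p\<close>, \<open>G\<^sub>p = \<integral> |\<nabla>\<psi>|\<^sup>2 \<omega>\<^sup>-\<^sup>p\<close> and \<open>a = d/2 - p\<close>, with \<open>p = 1 - k\<close>. Since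
  \<open>\<Delta>\<omega> = d/2 - \<omega>\<close> and \<open>|\<nabla>\<omega>|\<^sup>2 \<le> \<omega> - \<omega>\<^sup>2/d\<close>, integrating the divergence of \<open>|\<psi>|\<^sup>2 \<omega>\<^sup>-\<^sup>p \<nabla>\<omega>\<close>,
  a field whose normal component vanishes on the boundary of the cube, and absorbing
  \<open>2 \<psi> \<nabla>\<psi> \<cdot> \<nabla>\<omega>\<close> by \<open>(a/2) |\<psi>|\<^sup>2 |\<nabla>\<omega>|\<^sup>2/\<omega> + (2/a) |\<nabla>\<psi>|\<^sup>2 \<omega>\<close> gives
  \<open>A\<^sub>p \<le> C\<^sub>1 G\<^bsub>p-1\<^esub> + C\<^sub>2 A\<^bsub>p-1\<^esub>\<close>. Iterating down to \<open>A\<^sub>0 \<le> G\<^sub>0\<close>, the Poincare inequality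
  on the torus, and using \<open>G\<^bsub>p-1\<^esub> \<le> d G\<^sub>p\<close> yields \<open>H\<close>. The singularity of the weight is handled by
  replacing \<open>\<omega>\<close> by \<open>\<omega> + \<epsilon>\<close>; the case \<open>\<psi> = 1\<close> then shows that \<open>\<omega>\<^sup>-\<^sup>p\<close> is integrable. The Poincare
  inequality follows from Wirtinger's inequality in each variable, as the variance is at most the
  sum of the variances in the single variables.\<close>

subsection \<open>Averaging over one coordinate\<close>

definition upd :: "'n \<Rightarrow> real ^ 'n \<Rightarrow> real \<Rightarrow> real ^ 'n" where
  "upd i x t = (\<chi> j. if j = i then t else x $ j)"

lemma upd_nth [simp]: "upd i x t $ j = (if j = i then t else x $ j)"
  by (simp add: upd_def)

lemma upd_upd [simp]: "upd i (upd i x s) t = upd i x t"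
  by (simp add: vec_eq_iff)

lemma upd_commute: "i \<noteq> j \<Longrightarrow> upd i (upd j x s) t = upd j (upd i x t) s"
  by (simp add: vec_eq_iff)

lemma continuous_on_upd [continuous_intros]:
  assumes "continuous_on S f" "continuous_on S g"
  shows "continuous_on S (\<lambda>x. upd i (f x) (g x))"
  unfolding upd_def
proof (intro continuous_on_vec_lambda)
  show "continuous_on S (\<lambda>x. if j = i then g x else f x $ j)" for j
    using assms by (cases "j = i") (auto intro!: continuous_intros)
qed

lemma mem_Q_iff: "x \<in> Q \<longleftrightarrow> (\<forall>i. - pi < x $ i \<and> x $ i < pi)"
  by (simp add: Q_def mem_box_cart)

lemma closure_Q: "closure Q = cbox (\<chi> i. - pi) (\<chi> i. pi)"
proof -
  have "(0::real^'n) \<in> Q" by (simp add: mem_Q_iff)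
  then show ?thesis unfolding Q_def by (subst closure_box) auto
qed

lemma mem_closure_Q_iff: "x \<in> closure Q \<longleftrightarrow> (\<forall>i. - pi \<le> x $ i \<and> x $ i \<le> pi)"
  by (simp add: closure_Q mem_box_cart)

lemma prod_Basis_vec: "(\<Prod>b\<in>Basis. x \<bullet> b) = (\<Prod>j\<in>UNIV. (x :: real^'n) $ j)"
proof -
  have "Basis = range (\<lambda>j. axis j 1 :: real^'n)"
    by (auto simp: Basis_vec_def)
  then have "(\<Prod>b\<in>Basis. x \<bullet> b) = (\<Prod>b\<in>range (\<lambda>j. axis j 1). x \<bullet> b)"
    by (rule arg_cong)
  also have "\<dots> = (\<Prod>j\<in>UNIV. x $ j)"
    by (subst prod.reindex) (auto simp: inj_on_def axis_eq_axis inner_axis)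
  finally show ?thesis .
qed

lemma Q_borel [measurable]: "Q \<in> sets borel"
  by (simp add: Q_def)

lemma upd_mem_Q: "x \<in> Q \<Longrightarrow> - pi < t \<Longrightarrow> t < pi \<Longrightarrow> upd i x t \<in> Q"
  by (simp add: mem_Q_iff)

lemma borel_measurable_vec_nth' [measurable]:
  fixes f :: "'a \<Rightarrow> real ^ 'n"
  shows "f \<in> borel_measurable M \<Longrightarrow> (\<lambda>x. f x $ i) \<in> borel_measurable M"
  by (rule measurable_compose[OF _ borel_measurable_continuous_onI]) (auto intro!: continuous_intros)

lemma borel_measurable_upd [measurable]:
  "(\<lambda>z. upd i (fst z) (snd z)) \<in> (borel :: (real^'n) measure) \<Otimes>\<^sub>M borel \<rightarrow>\<^sub>M borel"
proof -
  have "(\<lambda>z. upd i (fst z :: real^'n) (snd z)) \<in> borel_measurable borel"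
    by (intro borel_measurable_continuous_onI continuous_intros)
  then show ?thesis by (simp add: borel_prod)
qed

text \<open>Fubini's theorem along one coordinate, without splitting off that coordinate: the old value of
  the resampled coordinate is averaged out over \<open>(-\<pi>, \<pi>)\<close>.\<close>

lemma lborel_eq_distr_upd:
  "lborel = distr (density (lborel \<Otimes>\<^sub>M lborel)
      (\<lambda>z. ennreal (indicator {- pi <..< pi} (fst z $ i) / (2 * pi)))) borel
      (\<lambda>z. upd i (fst z :: real^'n) (snd z))"
    (is "_ = distr (density ?P ?h) _ ?T")
proof (rule lborel_eqI)
  fix l u :: "real^'n"
  assume lu: "\<And>b. b \<in> Basis \<Longrightarrow> l \<bullet> b \<le> u \<bullet> b"
  have le: "l $ j \<le> u $ j" for j
    using lu[of "axis j 1"] by (simp add: inner_axis)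
  have [measurable]: "(\<lambda>x :: (real^'n) \<times> real. fst x $ i) \<in> borel_measurable (lborel \<Otimes>\<^sub>M lborel)"
    by measurable
  have [measurable]: "?h \<in> borel_measurable ?P" by simp
  have [measurable]: "?T \<in> density ?P ?h \<rightarrow>\<^sub>M borel" by simp
  have [measurable]: "?T \<in> ?P \<rightarrow>\<^sub>M borel" by simp
  \<comment> \<open>On the support of the density, the preimage of the box is again a product: its
    \<open>i\<close>-th side becomes (-pi, pi), and the original side reappears in the variable
    \<open>t\<close>. The length 2 pi of the new side cancels the density.\<close>
  let ?l = "upd i l (- pi)" and ?u = "upd i u pi"
  have "emeasure (distr (density ?P ?h) borel ?T) (box l u)
      = emeasure (density ?P ?h) (?T -` box l u \<inter> space ?P)"
    by (subst emeasure_distr) simp_all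
  also have "\<dots> = (\<integral>\<^sup>+z. ?h z * indicator (?T -` box l u \<inter> space ?P) z \<partial>?P)"
    by (intro emeasure_density) (measurable)
  also have "\<dots> = (\<integral>\<^sup>+z. ennreal (1 / (2 * pi)) * indicator (box ?l ?u \<times> box (l $ i) (u $ i)) z \<partial>?P)"
  proof (intro nn_integral_cong, goal_cases)
    case (1 z)
    have "?T z \<in> box l u \<and> fst z $ i \<in> {- pi <..< pi} \<longleftrightarrow> z \<in> box ?l ?u \<times> box (l $ i) (u $ i)"
      by (cases z) (auto simp: mem_box_cart split: if_splits)
    then show ?case
      by (auto simp: indicator_def space_pair_measure)
  qed
  also have "\<dots> = ennreal (1 / (2 * pi)) * (emeasure lborel (box ?l ?u) * emeasure lborel (box (l $ i) (u $ i)))"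
    by (subst nn_integral_cmult_indicator) (simp_all add: lborel.emeasure_pair_measure_Times)
  also have "emeasure lborel (box ?l ?u) = ennreal (\<Prod>b\<in>Basis. (?u - ?l) \<bullet> b)"
    using le by (intro emeasure_lborel_box) (auto simp: Basis_vec_def inner_axis)
  also have "(\<Prod>b\<in>Basis. (?u - ?l) \<bullet> b) = (\<Prod>j\<in>UNIV. (?u - ?l) $ j)"
    by (rule prod_Basis_vec)
  also have "\<dots> = 2 * pi * (\<Prod>j\<in>UNIV - {i}. (u - l) $ j)"
    by (subst prod.remove[of UNIV i]) (auto intro!: prod.cong)
  also have "emeasure lborel (box (l $ i) (u $ i)) = ennreal (u $ i - l $ i)"
    using le by simp
  also have "ennreal (1 / (2 * pi)) * (ennreal (2 * pi * (\<Prod>j\<in>UNIV - {i}. (u - l) $ j)) * ennreal (u $ i - l $ i))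
      = ennreal ((u - l) $ i * (\<Prod>j\<in>UNIV - {i}. (u - l) $ j))"
  proof -
    have "0 \<le> (\<Prod>j\<in>UNIV - {i}. (u - l) $ j)"
      using le by (intro prod_nonneg) simp
    then show ?thesis
      using le[of i] by (simp add: ennreal_mult[symmetric] mult_ac)
  qed
  also have "(u - l) $ i * (\<Prod>j\<in>UNIV - {i}. (u - l) $ j) = (\<Prod>j\<in>UNIV. (u - l) $ j)"
    by (rule prod.remove[symmetric]) auto
  also have "\<dots> = (\<Prod>b\<in>Basis. (u - l) \<bullet> b)"
    by (rule prod_Basis_vec[symmetric])
  finally show "emeasure (distr (density ?P ?h) borel ?T) (box l u) = (\<Prod>b\<in>Basis. (u - l) \<bullet> b)" .
qed simp

section \<open>The open cube as a finite measure space\<close>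

abbreviation cube :: "(real ^ 'n) measure" where
  "cube \<equiv> restrict_space lborel Q"

text \<open>The average remains a function of all coordinates, constant in the \<open>i\<close>-th
  one. It acts as a conditional expectation and can be iterated without changing the
  dimension.\<close>

definition coord_avg :: "'n \<Rightarrow> (real ^ 'n \<Rightarrow> real) \<Rightarrow> real ^ 'n \<Rightarrow> real" where
  "coord_avg i f x = integral {- pi..pi} (\<lambda>t. f (upd i x t)) / (2 * pi)"

lemma integral_cube: "integral\<^sup>L cube f = (LINT x:Q|lborel. f x)"
  for f :: "_ \<Rightarrow> 'b::{banach, second_countable_topology}"
  unfolding set_lebesgue_integral_def by (subst integral_restrict_space) auto

lemma space_cube [simp]: "space cube = Q"
  by (simp add: space_restrict_space)

lemma emeasure_cube_space: "emeasure cube (Q :: (real^'n) set) = ennreal ((2 * pi) ^ CARD('n))"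
proof -
  have "emeasure cube (Q :: (real^'n) set) = emeasure lborel (Q :: (real^'n) set)"
    by (subst emeasure_restrict_space) auto
  also have "\<dots> = (\<Prod>b\<in>Basis. ((\<chi> i. pi) - (\<chi> i. - pi) :: real^'n) \<bullet> b)"
    unfolding Q_def by (rule emeasure_lborel_box) (auto simp: Basis_vec_def inner_axis)
  also have "\<dots> = (2 * pi) ^ CARD('n)"
    by (subst prod_Basis_vec) simp
  finally show ?thesis .
qed

interpretation cube: finite_measure "cube :: (real^'n) measure"
  by standard (simp add: emeasure_cube_space)

lemma borel_measurable_cube:
  "f \<in> borel_measurable borel \<Longrightarrow> f \<in> borel_measurable cube"
  by (intro measurable_restrict_space1) simp

lemma bounded_on_Q:
  fixes h :: "real^'n \<Rightarrow> real"
  assumes "continuous_on UNIV h"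
  obtains B where "0 \<le> B" "\<And>x. x \<in> Q \<Longrightarrow> \<bar>h x\<bar> \<le> B"
proof -
  have "compact (closure (Q :: (real^'n) set))"
    by (simp add: closure_Q)
  then have "bounded (h ` closure Q)"
    using assms by (intro compact_imp_bounded compact_continuous_image)
      (auto intro: continuous_on_subset)
  then obtain B where B: "\<forall>x\<in>closure Q. \<bar>h x\<bar> \<le> B"
    by (auto simp: bounded_iff)
  have "\<bar>h x\<bar> \<le> \<bar>B\<bar>" if "x \<in> Q" for x
    using B closure_subset[of Q] that by (meson abs_ge_self order_trans subsetD)
  then show ?thesis using that[of "\<bar>B\<bar>"] by simp
qed

lemma integrable_cube:
  fixes f :: "real^'n \<Rightarrow> real"
  assumes "continuous_on UNIV f"
  shows "integrable cube f"
proof -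
  obtain B where "\<And>x. x \<in> Q \<Longrightarrow> \<bar>f x\<bar> \<le> B"
    using bounded_on_Q[OF assms] by blast
  then show ?thesis
    using assms
    by (intro cube.integrable_const_bound[where B=B])
      (auto intro!: AE_I2 borel_measurable_cube borel_measurable_continuous_onI)
qed

lemma integral_cube_coord_avg:
  fixes f :: "real^'n \<Rightarrow> real"
  assumes "continuous_on UNIV f"
  shows "integral\<^sup>L cube f = integral\<^sup>L cube (coord_avg i f)"
proof -
  let ?P = "(lborel :: (real^'n) measure) \<Otimes>\<^sub>M (lborel :: real measure)"
  let ?h = "\<lambda>z :: (real^'n) \<times> real. indicator {- pi <..< pi} (fst z $ i) / (2 * pi)"
  let ?T = "\<lambda>z. upd i (fst z :: real^'n) (snd z)"
  let ?F = "\<lambda>x. indicator Q x *\<^sub>R f x"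
  have [measurable]: "f \<in> borel_measurable borel"
    using assms by (rule borel_measurable_continuous_onI)
  have [measurable]: "(\<lambda>x :: (real^'n) \<times> real. fst x $ i) \<in> borel_measurable ?P"
    by measurable
  have h [measurable]: "?h \<in> borel_measurable ?P" by simp
  have T [measurable]: "?T \<in> ?P \<rightarrow>\<^sub>M borel" by simp
  have T' [measurable]: "?T \<in> density ?P ?h \<rightarrow>\<^sub>M borel" by simp
  have F [measurable]: "?F \<in> borel_measurable borel" by measurable
  have FT: "(\<lambda>z. ?F (?T z)) \<in> borel_measurable ?P" by measurable
  have "integrable lborel ?F"
    using integrable_cube[OF assms] by (subst (asm) integrable_restrict_space) auto
  then have "integrable (distr (density ?P ?h) borel ?T) ?F"
    by (simp flip: lborel_eq_distr_upd)
  then have int: "integrable ?P (\<lambda>z. ?h z *\<^sub>R ?F (?T z))"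
    by (subst (asm) integrable_distr_eq[OF T' F], subst (asm) integrable_density[OF FT h]) auto
  \<comment> \<open>The density tests the old \<open>i\<close>-th coordinate and \<open>Q\<close>
    tests all the others together with \<open>t\<close>. Jointly they say that \<open>x\<close> lies
    in \<open>Q\<close> and \<open>t\<close> in (-pi, pi), so the two integrations separate.\<close>
  have *: "?h (x, t) *\<^sub>R ?F (?T (x, t)) =
      indicator Q x * (indicator {- pi <..< pi} t * f (upd i x t) / (2 * pi))" for x t
    by (auto simp: indicator_def mem_Q_iff split: if_splits)
  have **: "(LINT t|lborel. indicator {- pi <..< pi} t * f (upd i x t) / (2 * pi)) = coord_avg i f x" for x
  proof -
    have "set_integrable lborel {- pi..pi} (\<lambda>t. f (upd i x t))"
      by (rule borel_integrable_atLeastAtMost')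
        (auto intro!: continuous_intros continuous_on_compose2[OF assms])
    then have "set_integrable lborel {- pi<..<pi} (\<lambda>t. f (upd i x t))"
      by (rule set_integrable_subset) auto
    then have "(LINT t:{- pi<..<pi}|lborel. f (upd i x t)) = integral {- pi<..<pi} (\<lambda>t. f (upd i x t))"
      by (rule set_borel_integral_eq_integral)
    also have "\<dots> = integral {- pi..pi} (\<lambda>t. f (upd i x t))"
      by (simp add: integral_open_interval_real)
    finally show ?thesis
      by (simp add: coord_avg_def set_lebesgue_integral_def)
  qed
  have "integral\<^sup>L cube f = integral\<^sup>L lborel ?F"
    by (subst integral_restrict_space) auto
  also have "\<dots> = integral\<^sup>L (distr (density ?P ?h) borel ?T) ?F"
    by (simp flip: lborel_eq_distr_upd)
  also have "\<dots> = integral\<^sup>L ?P (\<lambda>z. ?h z *\<^sub>R ?F (?T z))"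
    by (subst integral_distr[OF T' F], subst integral_density[OF FT h]) auto
  also have "\<dots> = (LINT x|lborel. LINT t|lborel. ?h (x, t) *\<^sub>R ?F (?T (x, t)))"
    by (rule lborel_pair.integral_fst'[symmetric, OF int])
  also have "\<dots> = (LINT x|lborel. indicator Q x *\<^sub>R coord_avg i f x)"
    unfolding * by (simp add: **[symmetric])
  also have "\<dots> = integral\<^sup>L cube (coord_avg i f)"
    by (subst integral_restrict_space) auto
  finally show ?thesis .
qed

subsection \<open>Wirtinger's inequality\<close>

text \<open>These are the poles of cot (z - c) within one period. The first and last cases arise
  only for c = 0 and c = - pi, where periodicity identifies the point with c + pi and c
  respectively.\<close>

lemma sin_zero_shift:
  fixes c z :: real
  assumes "sin (z - c) = 0" "- pi \<le> c" "c \<le> 0" "- pi \<le> z" "z \<le> pi"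
  shows "z = c - pi \<and> c = 0 \<or> z = c \<or> z = c + pi \<or> z = c + 2 * pi \<and> c = - pi"
proof -
  obtain n :: int where n: "z - c = of_int n * pi"
    using assms(1) by (auto simp: sin_zero_iff_int2)
  have "- 1 \<le> n" "n \<le> 2"
  proof -
    have "(-1) * pi \<le> of_int n * pi" "of_int n * pi \<le> 2 * pi"
      using assms n by linarith+
    then have "(-1) \<le> (of_int n :: real)" "(of_int n :: real) \<le> 2"
      by (metis mult_le_cancel_right_pos pi_gt_zero)+
    then show "- 1 \<le> n" "n \<le> 2" by linarith+
  qed
  then consider "n = -1" | "n = 0" | "n = 1" | "n = 2" by linarith
  then show ?thesis using n assms by cases auto
qed

text \<open>Shifting by a multiple of pi changes a sine at most in sign. Near a pole
  \<open>z\<close> of cot (x - c) this allows comparison with sin (x - z).\<close>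

lemma sin_shift_abs:
  fixes c z x :: real
  assumes "sin (z - c) = 0"
  shows "\<bar>sin (x - c)\<bar> = \<bar>sin (x - z)\<bar>"
proof -
  have "\<bar>cos (z - c)\<bar> = 1"
    using assms sin_cos_squared_add[of "z - c"] by (auto simp: power2_eq_1_iff)
  moreover have "sin (x - c) = sin (x - z) * cos (z - c)"
    using sin_add[of "x - z" "z - c"] assms by simp
  ultimately show ?thesis by (simp add: abs_mult)
qed

text \<open>A symmetric pair \<open>f c = f (c + \<pi>) = m\<close> exists by the intermediate value theorem, and
  \<open>f'\<^sup>2 - (f - m)\<^sup>2 = (f' - (f - m) cot (x - c))\<^sup>2 + ((f - m)\<^sup>2 cot (x - c))'\<close>, where the last term
  integrates to \<open>0\<close> by periodicity.\<close>

lemma wirtinger_shifted: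
  fixes f f' :: "real \<Rightarrow> real"
  assumes cf: "continuous_on {- pi..pi} f" and cf': "continuous_on {- pi..pi} f'"
    and deriv: "\<And>t. - pi < t \<Longrightarrow> t < pi \<Longrightarrow> (f has_real_derivative f' t) (at t)"
    and per: "f (- pi) = f pi"
  obtains m where "integral {- pi..pi} (\<lambda>t. (f t - m)\<^sup>2) \<le> integral {- pi..pi} (\<lambda>t. (f' t)\<^sup>2)"
proof -
  have "\<exists>c\<ge>- pi. c \<le> 0 \<and> f (c + pi) - f c = 0"
  proof -
    let ?g = "\<lambda>x. f (x + pi) - f x"
    have g: "continuous_on {- pi..0} ?g"
      by (intro continuous_intros continuous_on_compose2[OF cf] continuous_on_subset[OF cf]) auto
    \<comment> \<open>By periodicity the half-period difference has opposite signs at the two ends,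
      which is what the intermediate value theorem needs.\<close>
    have "?g 0 = - ?g (- pi)" using per by simp
    then consider "?g (- pi) \<le> 0 \<and> 0 \<le> ?g 0" | "?g 0 \<le> 0 \<and> 0 \<le> ?g (- pi)"
      by linarith
    then show ?thesis
      by cases (use IVT'[of ?g "- pi" 0 0] IVT2'[of ?g 0 0 "- pi"] g pi_ge_zero in auto)
  qed
  then obtain c where c: "- pi \<le> c" "c \<le> 0" "f (c + pi) = f c"
    by auto
  define m where "m = f c"
  define h where "h t = f t - m" for t
  have ch: "continuous_on {- pi..pi} h"
    unfolding h_def by (intro continuous_intros cf)
  have dh: "(h has_real_derivative f' t) (at t)" if "- pi < t" "t < pi" for t
    unfolding h_def using deriv[OF that] by (auto intro!: derivative_eq_intros)
  have hz: "h z = 0" if "sin (z - c) = 0" "- pi \<le> z" "z \<le> pi" for z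
    using sin_zero_shift[OF that(1) c(1,2) that(2,3)] c per by (auto simp: h_def m_def)
  obtain M where M: "\<And>t. t \<in> {- pi..pi} \<Longrightarrow> \<bar>f' t\<bar> \<le> M"
  proof -
    have "bounded (f' ` {- pi..pi})"
      by (intro compact_imp_bounded compact_continuous_image cf') auto
    then obtain B where "\<forall>t\<in>{- pi..pi}. \<bar>f' t\<bar> \<le> B" by (auto simp: bounded_iff)
    then show ?thesis using that[of B] by auto
  qed
  have M0: "M \<ge> 0" using M[of 0] by auto
  have lip1: "\<bar>h y - h x\<bar> \<le> M * (y - x)" if xy: "x < y" "- pi \<le> x" "y \<le> pi" for x y
  proof -
    have "\<exists>\<xi>. x < \<xi> \<and> \<xi> < y \<and> h y - h x = (\<lambda>d. d * f' \<xi>) (y - x)"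
    proof (rule mvt[OF xy(1)])
      show "continuous_on {x..y} h" by (rule continuous_on_subset[OF ch]) (use xy in auto)
      show "(h has_derivative (\<lambda>d. d * f' t)) (at t)" if "x < t" "t < y" for t
        using dh[of t] that xy by (simp add: has_field_derivative_def mult.commute[of _ "f' t"])
    qed auto
    then obtain \<xi> where "x < \<xi>" "\<xi> < y" "h y - h x = (y - x) * f' \<xi>" by auto
    then show ?thesis using M[of \<xi>] xy
      by (auto simp: abs_mult mult.commute intro!: mult_right_mono)
  qed
  have lip: "\<bar>h y - h x\<bar> \<le> M * \<bar>y - x\<bar>" if "x \<in> {- pi..pi}" "y \<in> {- pi..pi}" for x y
    using lip1[of x y] lip1[of y x] that by (cases x y rule: linorder_cases) (auto simp: abs_minus_commute)
  \<comment> \<open>At a pole of the cotangent, division by zero makes \<open>F\<close> zero. This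
    is also its limit: \<open>h\<close> vanishes there and is Lipschitz with constant
    \<open>M\<close>, so its square has order two against a simple pole.\<close>
  define F where "F t = (h t)\<^sup>2 * (cos (t - c) / sin (t - c))" for t
  have cF: "continuous_on {- pi..pi} F"
    unfolding continuous_on_def
  proof
    fix z assume z: "z \<in> {- pi..pi}"
    show "(F \<longlongrightarrow> F z) (at z within {- pi..pi})"
    proof (cases "sin (z - c) = 0")
      case False
      have "(h \<longlongrightarrow> h z) (at z within {- pi..pi})"
        using ch z by (auto simp: continuous_on_def)
      then show ?thesis unfolding F_def using False by (intro tendsto_intros) auto
    next
      case True
      have "(F \<longlongrightarrow> 0) (at z within {- pi..pi})"
      proof (rule Lim_null_comparison)
        show "\<forall>\<^sub>F x in at z within {- pi..pi}. norm (F x) \<le> M\<^sup>2 * (\<bar>x - z\<bar> * \<bar>(x - z) / sin (x - z)\<bar>)"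
          unfolding eventually_at_filter
        proof (intro always_eventually allI impI)
          fix x assume x: "x \<in> {- pi..pi}"
          have "\<bar>h x\<bar> \<le> M * \<bar>x - z\<bar>"
            using lip[of z x] x z hz[OF True] by auto
          then have "(h x)\<^sup>2 \<le> M\<^sup>2 * (\<bar>x - z\<bar> * \<bar>x - z\<bar>)"
            using power_mono[of "\<bar>h x\<bar>" "M * \<bar>x - z\<bar>" 2] by (simp add: power_mult_distrib flip: power2_eq_square)
          moreover have "\<bar>cos (x - c) / sin (x - c)\<bar> \<le> 1 / \<bar>sin (x - z)\<bar>"
            by (simp add: sin_shift_abs[OF True] abs_divide divide_right_mono)
          ultimately have "(h x)\<^sup>2 * \<bar>cos (x - c) / sin (x - c)\<bar> \<le> (M\<^sup>2 * (\<bar>x - z\<bar> * \<bar>x - z\<bar>)) * (1 / \<bar>sin (x - z)\<bar>)"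
            by (intro mult_mono) auto
          then show "norm (F x) \<le> M\<^sup>2 * (\<bar>x - z\<bar> * \<bar>(x - z) / sin (x - z)\<bar>)"
            by (simp add: F_def abs_mult abs_divide)
        qed
        have "((\<lambda>x. (x - z) / sin (x - z)) \<longlongrightarrow> 1) (at z)"
        proof -
          have "((\<lambda>x::real. sin x / x) \<longlongrightarrow> 1) (at 0)"
            using DERIV_sin[of 0] by (simp add: DERIV_def)
          then have "((\<lambda>x::real. inverse (sin x / x)) \<longlongrightarrow> inverse 1) (at 0)"
            by (intro tendsto_intros) auto
          then have "((\<lambda>x::real. x / sin x) \<longlongrightarrow> 1) (at 0)" by simp
          then show ?thesis
            by (subst (asm) LIM_offset_zero_iff[symmetric, of z "\<lambda>x. (x - z) / sin (x - z)", simplified]) auto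
        qed
        then have "((\<lambda>x. (x - z) / sin (x - z)) \<longlongrightarrow> 1) (at z within {- pi..pi})"
          by (rule tendsto_within_subset) auto
        then have "((\<lambda>x. M\<^sup>2 * (\<bar>x - z\<bar> * \<bar>(x - z) / sin (x - z)\<bar>)) \<longlongrightarrow> M\<^sup>2 * (\<bar>z - z\<bar> * \<bar>1\<bar>)) (at z within {- pi..pi})"
          by (intro tendsto_intros)
        then show "((\<lambda>x. M\<^sup>2 * (\<bar>x - z\<bar> * \<bar>(x - z) / sin (x - z)\<bar>)) \<longlongrightarrow> 0) (at z within {- pi..pi})"
          by simp
      qed
      then show ?thesis using True by (simp add: F_def)
    qed
  qed
  let ?S = "{c - pi, c, c + pi, c + 2 * pi}"
  let ?F' = "\<lambda>t. 2 * h t * f' t * (cos (t - c) / sin (t - c)) - (h t)\<^sup>2 / (sin (t - c))\<^sup>2"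
  have dF: "(F has_real_derivative ?F' t) (at t)"
    if t: "t \<in> {- pi<..<pi} - ?S" for t
  proof -
    have s: "sin (t - c) \<noteq> 0" using sin_zero_shift[OF _ c(1,2), of t] t by auto
    have "((\<lambda>t. cos (t - c) / sin (t - c)) has_real_derivative - 1 / (sin (t - c))\<^sup>2) (at t)"
    proof -
      have "- (sin (t - c) * sin (t - c)) - cos (t - c) * cos (t - c) = - 1"
        using sin_cos_squared_add[of "t - c"] unfolding power2_eq_square by linarith
      then show ?thesis using s
        by (auto intro!: derivative_eq_intros simp: power2_eq_square)
    qed
    moreover have "((\<lambda>t. (h t)\<^sup>2) has_real_derivative 2 * h t * f' t) (at t)"
      using t by (auto intro!: derivative_eq_intros dh)
    ultimately have "(F has_real_derivative 2 * h t * f' t * (cos (t - c) / sin (t - c))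
        + - 1 / (sin (t - c))\<^sup>2 * (h t)\<^sup>2) (at t)"
      unfolding F_def by (intro DERIV_mult)
    then show ?thesis by simp
  qed
  \<comment> \<open>This form of the fundamental theorem asks only for continuity at the finitely
    many points of \<open>?S\<close>, which contain all the poles.\<close>
  have "(?F' has_integral F pi - F (- pi)) {- pi..pi}"
    by (rule fundamental_theorem_of_calculus_interior_strong[of ?S])
      (use dF cF in \<open>auto simp: has_real_derivative_iff_has_vector_derivative\<close>)
  moreover have "F pi = F (- pi)"
  proof -
    have "h pi = h (- pi)" using per by (simp add: h_def)
    then show ?thesis by (simp add: F_def sin_diff cos_diff)
  qed
  ultimately have F'0: "(?F' has_integral 0) {- pi..pi}" by simp
  have If': "(\<lambda>t. (f' t)\<^sup>2) integrable_on {- pi..pi}"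
    by (intro integrable_continuous_real continuous_intros cf')
  have Ih: "(\<lambda>t. (h t)\<^sup>2) integrable_on {- pi..pi}"
    by (intro integrable_continuous_real continuous_intros ch)
  let ?D = "\<lambda>t. (f' t)\<^sup>2 - (h t)\<^sup>2 - ?F' t"
  have D: "(?D has_integral (integral {- pi..pi} (\<lambda>t. (f' t)\<^sup>2) - integral {- pi..pi} (\<lambda>t. (h t)\<^sup>2) - 0)) {- pi..pi}"
    by (intro has_integral_diff F'0 integrable_integral If' Ih)
  have "0 \<le> ?D t" if t: "t \<in> {- pi..pi}" for t
  proof (cases "sin (t - c) = 0")
    \<comment> \<open>At a pole \<open>h\<close> is zero and the quotients are zero by convention,
      so only the square of \<open>f'\<close> remains.\<close>
    case True
    then show ?thesis using hz[OF True] t by simp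
  next
    case False
    define k where "k = cos (t - c) / sin (t - c)"
    have "1 / (sin (t - c))\<^sup>2 = 1 + k\<^sup>2"
      using False sin_cos_squared_add[of "t - c"] by (simp add: k_def power_divide field_simps)
    then have "?D t = (f' t)\<^sup>2 - (h t)\<^sup>2 - (2 * h t * f' t * k - (h t)\<^sup>2 * (1 + k\<^sup>2))"
      unfolding k_def by (metis (no_types, lifting) mult.right_neutral times_divide_eq_right)
    also have "\<dots> = (f' t - h t * k)\<^sup>2" by (simp add: power2_eq_square algebra_simps)
    finally show ?thesis by simp
  qed
  from has_integral_nonneg[OF D this]
  show ?thesis by (intro that[of m]) (simp add: h_def)
qed

text \<open>Among all constants the mean minimises the quadratic deviation. For another constant
  \<open>m\<close> the deviation is larger by 2 pi (a - m)^2, so the \<open>m\<close> of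
  \<open>wirtinger_shifted\<close> can be replaced by \<open>a\<close>.\<close>

lemma wirtinger:
  fixes f f' :: "real \<Rightarrow> real"
  assumes "continuous_on {- pi..pi} f" "continuous_on {- pi..pi} f'"
    and "\<And>t. - pi < t \<Longrightarrow> t < pi \<Longrightarrow> (f has_real_derivative f' t) (at t)"
    and "f (- pi) = f pi"
  defines "a \<equiv> integral {- pi..pi} f / (2 * pi)"
  shows "integral {- pi..pi} (\<lambda>t. (f t - a)\<^sup>2) \<le> integral {- pi..pi} (\<lambda>t. (f' t)\<^sup>2)"
proof -
  obtain m where m: "integral {- pi..pi} (\<lambda>t. (f t - m)\<^sup>2) \<le> integral {- pi..pi} (\<lambda>t. (f' t)\<^sup>2)"
    using wirtinger_shifted[OF assms(1-4)] by blast
  have f: "(f has_integral 2 * pi * a) {- pi..pi}"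
    using integrable_integral[OF integrable_continuous_real[OF assms(1)]] by (simp add: a_def)
  let ?I = "integral {- pi..pi} (\<lambda>t. (f t - a)\<^sup>2)"
  have "((\<lambda>t. (f t - a)\<^sup>2) has_integral ?I) {- pi..pi}"
    by (intro integrable_integral integrable_continuous_real continuous_intros assms)
  moreover have "((\<lambda>t. 2 * (a - m) * (f t - a)) has_integral 2 * (a - m) * (2 * pi * a - (pi - - pi) *\<^sub>R a)) {- pi..pi}"
    using has_integral_const_real[of a "- pi" pi]
    by (intro has_integral_mult_right has_integral_diff f) simp
  moreover have "((\<lambda>t. (a - m)\<^sup>2) has_integral (pi - - pi) *\<^sub>R (a - m)\<^sup>2) {- pi..pi}"
    using has_integral_const_real[of "(a - m)\<^sup>2" "- pi" pi] by simp
  ultimately have "((\<lambda>t. (f t - a)\<^sup>2 + 2 * (a - m) * (f t - a) + (a - m)\<^sup>2) has_integral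
      ?I + 2 * (a - m) * (2 * pi * a - (pi - - pi) *\<^sub>R a) + (pi - - pi) *\<^sub>R (a - m)\<^sup>2) {- pi..pi}"
    by (intro has_integral_add)
  also have "(\<lambda>t. (f t - a)\<^sup>2 + 2 * (a - m) * (f t - a) + (a - m)\<^sup>2) = (\<lambda>t. (f t - m)\<^sup>2)"
    by (simp add: fun_eq_iff power2_eq_square algebra_simps)
  finally have "integral {- pi..pi} (\<lambda>t. (f t - m)\<^sup>2) = ?I + 2 * pi * (a - m)\<^sup>2"
    by (simp add: integral_unique)
  moreover have "0 \<le> 2 * pi * (a - m)\<^sup>2" by simp
  ultimately show ?thesis using m by linarith
qed

subsection \<open>The Poincare inequality on the cube\<close>

lemma continuous_on_coord_avg:
  fixes f :: "real^'n \<Rightarrow> real"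
  assumes "continuous_on UNIV f"
  shows "continuous_on UNIV (coord_avg i f)"
proof -
  have "continuous_on (UNIV \<times> cbox (- pi) pi) (\<lambda>(x, t). f (upd i x t))"
    by (auto simp: case_prod_beta intro!: continuous_intros continuous_on_compose2[OF assms])
  then show ?thesis
    unfolding coord_avg_def cbox_interval[symmetric]
    by (intro continuous_intros integral_continuous_on_param) auto
qed

lemma integrable_on_upd:
  fixes f :: "real^'n \<Rightarrow> real"
  assumes "continuous_on UNIV f"
  shows "(\<lambda>t. f (upd i x t)) integrable_on {a..b}"
  by (intro integrable_continuous_real continuous_on_compose2[OF assms] continuous_intros) auto

lemma coord_avg_upd [simp]: "coord_avg i f (upd i x t) = coord_avg i f x"
  by (simp add: coord_avg_def)

lemma coord_avg_diff:
  assumes "continuous_on UNIV f" "continuous_on UNIV g"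
  shows "coord_avg i (\<lambda>x. f x - g x) x = coord_avg i f x - coord_avg i g x"
  unfolding coord_avg_def
  by (subst integral_diff) (auto intro: integrable_on_upd assms simp: diff_divide_distrib)

lemma coord_avg_mult_invariant:
  assumes "\<And>x t. g (upd i x t) = g x"
  shows "coord_avg i (\<lambda>x. f x * g x) x = coord_avg i f x * g x"
  by (simp add: coord_avg_def assms)

lemma coord_avg_mono:
  assumes "integral {- pi..pi} (\<lambda>t. f (upd i x t)) \<le> integral {- pi..pi} (\<lambda>t. g (upd i x t))"
  shows "coord_avg i f x \<le> coord_avg i g x"
  unfolding coord_avg_def by (intro divide_right_mono assms) simp

lemma coord_avg_commute:
  fixes f :: "real^'n \<Rightarrow> real"
  assumes "continuous_on UNIV f"
  shows "coord_avg i (coord_avg j f) x = coord_avg j (coord_avg i f) x"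
proof (cases "i = j")
  case False
  have "continuous_on (cbox (- pi, - pi) (pi, pi)) (\<lambda>(s, t). f (upd j (upd i x s) t))"
    by (auto simp: case_prod_beta intro!: continuous_intros continuous_on_compose2[OF assms])
  from integral_swap_continuous[OF this]
  have "integral {- pi..pi} (\<lambda>s. integral {- pi..pi} (\<lambda>t. f (upd j (upd i x s) t)))
      = integral {- pi..pi} (\<lambda>t. integral {- pi..pi} (\<lambda>s. f (upd i (upd j x t) s)))"
    by (simp add: cbox_interval upd_commute[OF False])
  then show ?thesis
    by (simp add: coord_avg_def)
qed simp

text \<open>The average does not depend on coordinate \<open>i\<close> and factors out when its
  product with \<open>f\<close> is averaged. Hence \<open>f - coord_avg i f\<close> is orthogonal to
  \<open>coord_avg i f\<close> in L^2 of the cube.\<close>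

lemma pythagoras_coord_avg:
  fixes f :: "real^'n \<Rightarrow> real"
  assumes f: "continuous_on UNIV f"
  shows "(LINT x|cube. (f x)\<^sup>2) = (LINT x|cube. (f x - coord_avg i f x)\<^sup>2) + (LINT x|cube. (coord_avg i f x)\<^sup>2)"
proof -
  let ?a = "coord_avg i f"
  have a: "continuous_on UNIV ?a" by (rule continuous_on_coord_avg[OF f])
  have "(LINT x|cube. f x * ?a x) = (LINT x|cube. coord_avg i (\<lambda>x. f x * ?a x) x)"
    by (rule integral_cube_coord_avg) (intro continuous_intros f a)
  also have "\<dots> = (LINT x|cube. (?a x)\<^sup>2)"
    by (subst coord_avg_mult_invariant) (simp_all add: power2_eq_square)
  finally have *: "(LINT x|cube. f x * ?a x) = (LINT x|cube. (?a x)\<^sup>2)" .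
  have "(LINT x|cube. (f x)\<^sup>2) = (LINT x|cube. (f x - ?a x)\<^sup>2 + 2 * (f x * ?a x - (?a x)\<^sup>2) + (?a x)\<^sup>2)"
    by (simp add: power2_eq_square algebra_simps)
  also have "\<dots> = (LINT x|cube. (f x - ?a x)\<^sup>2) + 2 * ((LINT x|cube. f x * ?a x) - (LINT x|cube. (?a x)\<^sup>2))
      + (LINT x|cube. (?a x)\<^sup>2)"
    by (simp only: Bochner_Integration.integral_add Bochner_Integration.integral_diff
        integral_mult_right_zero integrable_cube Bochner_Integration.integrable_add
        Bochner_Integration.integrable_diff integrable_mult_right continuous_on_diff continuous_on_mult
        continuous_on_power f a)
  finally show ?thesis using * by simp
qed

section \<open>Iterated averages and the Efron-Stein inequality\<close>

lemma continuous_on_foldr_coord_avg: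
  "continuous_on UNIV f \<Longrightarrow> continuous_on UNIV (foldr coord_avg is f)"
  by (induction "is") (auto intro: continuous_on_coord_avg)

lemma foldr_coord_avg_diff:
  assumes "continuous_on UNIV f" "continuous_on UNIV g"
  shows "foldr coord_avg is (\<lambda>x. f x - g x) = (\<lambda>x. foldr coord_avg is f x - foldr coord_avg is g x)"
  by (induction "is")
    (auto intro!: ext simp: coord_avg_diff continuous_on_foldr_coord_avg assms)

lemma foldr_coord_avg_commute:
  assumes "continuous_on UNIV f"
  shows "foldr coord_avg is (coord_avg j f) = coord_avg j (foldr coord_avg is f)"
  by (induction "is")
    (auto intro!: ext coord_avg_commute simp: continuous_on_foldr_coord_avg assms)

lemma foldr_coord_avg_contraction:
  fixes f :: "real^'n \<Rightarrow> real"
  assumes "continuous_on UNIV f"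
  shows "(LINT x|cube. (foldr coord_avg is f x)\<^sup>2) \<le> (LINT x|cube. (f x)\<^sup>2)"
proof (induction "is")
  case (Cons i "is")
  let ?g = "foldr coord_avg is f"
  have "0 \<le> (LINT x|cube. (?g x - coord_avg i ?g x)\<^sup>2)" by simp
  with Cons pythagoras_coord_avg[OF continuous_on_foldr_coord_avg[OF assms], of "is" i]
  have "(LINT x|cube. (coord_avg i ?g x)\<^sup>2) \<le> (LINT x|cube. (f x)\<^sup>2)"
    by linarith
  then show ?case by simp
qed simp

text \<open>Pythagoras is telescoped along the list. The variance split off for \<open>i\<close> is
  that of an already averaged function; since averages commute, it is the squared norm of an average
  of \<open>f - coord_avg i f\<close>, and averaging contracts the norm.\<close>

lemma efron_stein:
  fixes f :: "real^'n \<Rightarrow> real"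
  assumes f: "continuous_on UNIV f"
  shows "(LINT x|cube. (f x)\<^sup>2) \<le> (\<Sum>i\<leftarrow>is. LINT x|cube. (f x - coord_avg i f x)\<^sup>2)
      + (LINT x|cube. (foldr coord_avg is f x)\<^sup>2)"
proof (induction "is")
  case (Cons i "is")
  let ?g = "foldr coord_avg is f"
  have "(\<lambda>x. ?g x - coord_avg i ?g x) = foldr coord_avg is (\<lambda>x. f x - coord_avg i f x)"
    by (simp add: foldr_coord_avg_diff foldr_coord_avg_commute continuous_on_coord_avg f)
  then have "(LINT x|cube. (?g x - coord_avg i ?g x)\<^sup>2) \<le> (LINT x|cube. (f x - coord_avg i f x)\<^sup>2)"
    using foldr_coord_avg_contraction[of "\<lambda>x. f x - coord_avg i f x" "is"]
    by (simp add: fun_eq_iff continuous_on_diff continuous_on_coord_avg f)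
  then show ?case
    using Cons pythagoras_coord_avg[OF continuous_on_foldr_coord_avg[OF f], of "is" i] by simp
qed simp

text \<open>Each averaging removes the dependence on its coordinate. For a list of all coordinates
  the result is therefore a constant.\<close>

lemma foldr_coord_avg_cong:
  assumes "\<And>j. j \<notin> set is \<Longrightarrow> x $ j = y $ j"
  shows "foldr coord_avg is f x = foldr coord_avg is f y"
  using assms
proof (induction "is" arbitrary: x y)
  case Nil
  then have "x = y" by (simp add: vec_eq_iff)
  then show ?case by simp
next
  case (Cons i "is")
  have "foldr coord_avg is f (upd i x t) = foldr coord_avg is f (upd i y t)" for t
    by (rule Cons.IH) (use Cons.prems in auto)
  then have "coord_avg i (foldr coord_avg is f) x = coord_avg i (foldr coord_avg is f) y"
    unfolding coord_avg_def[of i] by simp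
  then show ?case by simp
qed

lemma integral_foldr_coord_avg:
  fixes f :: "real^'n \<Rightarrow> real"
  assumes "continuous_on UNIV f"
  shows "integral\<^sup>L cube (foldr coord_avg is f) = integral\<^sup>L cube f"
  by (induction "is")
    (simp_all add: integral_cube_coord_avg[OF continuous_on_foldr_coord_avg[OF assms], symmetric])

text \<open>A \<open>C\<^sup>1\<close> function on the closed cube together with its partial derivatives, all
  extended continuously (in any way) to the whole space.\<close>

definition cube_C1 :: "(real ^ 'n \<Rightarrow> real) \<Rightarrow> ('n \<Rightarrow> real ^ 'n \<Rightarrow> real) \<Rightarrow> bool" where
  "cube_C1 f g \<longleftrightarrow> continuous_on UNIV f \<and> (\<forall>i. continuous_on UNIV (g i)) \<and>
     (\<forall>i. \<forall>x\<in>Q. \<forall>t\<in>{- pi<..<pi}. ((\<lambda>t. f (upd i x t)) has_real_derivative g i (upd i x t)) (at t))"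

lemma poincare_cube:
  fixes f :: "real^'n \<Rightarrow> real"
  assumes C1: "cube_C1 f g"
    and per: "\<And>i x. x \<in> Q \<Longrightarrow> f (upd i x (- pi)) = f (upd i x pi)"
    and mean: "(LINT x|cube. f x) = 0"
  shows "(LINT x|cube. (f x)\<^sup>2) \<le> (LINT x|cube. (\<Sum>i\<in>UNIV. (g i x)\<^sup>2))"
proof -
  have f: "continuous_on UNIV f" and g: "continuous_on UNIV (g i)" for i
    using C1 by (auto simp: cube_C1_def)
  have deriv: "((\<lambda>t. f (upd i x t)) has_real_derivative g i (upd i x t)) (at t)"
    if "x \<in> Q" "- pi < t" "t < pi" for i x t
    using C1 that by (auto simp: cube_C1_def)
  have 1: "(LINT x|cube. (f x - coord_avg i f x)\<^sup>2) \<le> (LINT x|cube. (g i x)\<^sup>2)" for i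
  proof -
    let ?v = "\<lambda>x. (f x - coord_avg i f x)\<^sup>2" and ?w = "\<lambda>x. (g i x)\<^sup>2"
    have v: "continuous_on UNIV ?v" and w: "continuous_on UNIV ?w"
      by (intro continuous_intros f g continuous_on_coord_avg)+
    \<comment> \<open>Along the line through \<open>x\<close> in direction \<open>i\<close>, the
      subtracted average is the mean of the restriction of \<open>f\<close>, so Wirtinger's
      inequality applies line by line.\<close>
    have "coord_avg i ?v x \<le> coord_avg i ?w x" if x: "x \<in> Q" for x
    proof (rule coord_avg_mono)
      have "integral {- pi..pi} (\<lambda>t. (f (upd i x t) - integral {- pi..pi} (\<lambda>t. f (upd i x t)) / (2 * pi))\<^sup>2)
          \<le> integral {- pi..pi} (\<lambda>t. (g i (upd i x t))\<^sup>2)"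
        by (intro wirtinger continuous_on_compose2[OF f] continuous_on_compose2[OF g] continuous_intros)
          (auto intro: deriv per x)
      then show "integral {- pi..pi} (\<lambda>t. ?v (upd i x t)) \<le> integral {- pi..pi} (\<lambda>t. ?w (upd i x t))"
        unfolding coord_avg_upd by (simp only: coord_avg_def)
    qed
    then have "(LINT x|cube. coord_avg i ?v x) \<le> (LINT x|cube. coord_avg i ?w x)"
      by (intro integral_mono integrable_cube continuous_on_coord_avg v w) auto
    then show ?thesis
      by (simp add: integral_cube_coord_avg[OF v, symmetric] integral_cube_coord_avg[OF w, symmetric])
  qed
  obtain "is" :: "'n list" where "is": "set is = UNIV" "distinct is"
    using finite_distinct_list[OF finite[of UNIV]] by blast
  \<comment> \<open>The average over all coordinates is constant and has the same integral as
    \<open>f\<close>, namely zero. So the last term of \<open>efron_stein\<close> vanishes.\<close>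
  define c where "c = foldr coord_avg is f 0"
  have c: "foldr coord_avg is f = (\<lambda>x. c)"
    unfolding c_def using "is" by (auto intro: foldr_coord_avg_cong)
  have "c * (2 * pi) ^ CARD('n) = integral\<^sup>L cube (\<lambda>x :: real^'n. c)"
    by (simp add: measure_def emeasure_cube_space mult.commute)
  also have "\<dots> = 0"
    using integral_foldr_coord_avg[OF f, of "is"] mean by (simp only: c)
  finally have "c = 0" by simp
  then have "(LINT x|cube. (f x)\<^sup>2) \<le> (\<Sum>i\<leftarrow>is. LINT x|cube. (f x - coord_avg i f x)\<^sup>2)"
    using efron_stein[OF f, of "is"] by (simp add: c)
  also have "\<dots> = (\<Sum>i\<in>UNIV. LINT x|cube. (f x - coord_avg i f x)\<^sup>2)"
    using "is" by (simp add: sum_list_distinct_conv_sum_set)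
  also have "\<dots> \<le> (\<Sum>i\<in>UNIV. LINT x|cube. (g i x)\<^sup>2)"
    by (intro sum_mono 1)
  also have "\<dots> = (LINT x|cube. (\<Sum>i\<in>UNIV. (g i x)\<^sup>2))"
    by (intro Bochner_Integration.integral_sum[symmetric] integrable_cube continuous_intros g)
  finally show ?thesis .
qed

subsection \<open>The weighted inequality for the regularized weight\<close>

lemma omega_nonneg: "0 \<le> \<omega> x"
  by (simp add: \<omega>_def sum_nonneg)

lemma omega_le_card: "\<omega> (x :: real^'n) \<le> CARD('n)"
proof -
  have "\<omega> x \<le> (\<Sum>j\<in>(UNIV :: 'n set). 1)"
    unfolding \<omega>_def by (intro sum_mono) (simp add: abs_square_le_1)
  then show ?thesis by simp
qed

lemma omega_pos:
  assumes "x \<in> Q" "x \<noteq> 0"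
  shows "0 < \<omega> x"
proof -
  obtain j where j: "x $ j \<noteq> 0" using assms(2) by (auto simp: vec_eq_iff)
  have "- pi < x $ j" "x $ j < pi" using assms(1) by (auto simp: mem_Q_iff)
  then have "\<bar>x $ j / 2\<bar> < pi" by linarith
  then have "sin (x $ j / 2) \<noteq> 0"
    using sin_zero_pi_iff[of "x $ j / 2"] j by auto
  then show ?thesis
    unfolding \<omega>_def by (intro sum_pos2[of _ j]) auto
qed

lemma AE_omega_pos: "AE x in cube. 0 < \<omega> (x :: real^'n)"
proof -
  have "AE x in lborel. (x :: real^'n) \<noteq> 0"
    by (rule AE_I[of _ _ "{0}"]) auto
  then have "AE x in lborel. x \<in> Q \<longrightarrow> 0 < \<omega> (x :: real^'n)"
    by eventually_elim (auto intro: omega_pos)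
  then show ?thesis
    by (subst AE_restrict_space_iff) auto
qed

lemma continuous_on_omega [continuous_intros]: "continuous_on S \<omega>"
  unfolding \<omega>_def by (intro continuous_intros) auto

lemma has_real_derivative_omega_upd:
  "((\<lambda>t. \<omega> (upd i x t)) has_real_derivative sin t / 2) (at t)"
proof -
  have "\<omega> (upd i x t) = (sin (t / 2))\<^sup>2 + (\<Sum>j\<in>UNIV - {i}. (sin (x $ j / 2))\<^sup>2)" for t
    unfolding \<omega>_def by (subst sum.remove[of UNIV i]) (auto intro!: sum.cong)
  then show ?thesis
    using sin_double[of "t / 2"] by (auto intro!: derivative_eq_intros)
qed

text \<open>The second derivative of \<omega> in direction \<open>i\<close> is half of cos (x $ i).
  This is thus the formula for the Laplacian of \<omega>, multiplied by 2.\<close>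

lemma sum_cos_eq_omega: "(\<Sum>i\<in>UNIV. cos (x $ i)) = CARD('n) - 2 * \<omega> (x :: real^'n)"
proof -
  have "cos (x $ i) = 1 - 2 * (sin (x $ i / 2))\<^sup>2" for i
    using cos_double_sin[of "x $ i / 2"] by simp
  then show ?thesis
    by (simp add: \<omega>_def sum_subtractf sum_distrib_left)
qed

text \<open>With s = sin^2 (x $ i / 2), the squared \<open>i\<close>-th derivative of \<omega> is s
  - s^2. Cauchy-Schwarz bounds the sum of the s^2 below by the square of their sum divided by the
  dimension.\<close>

lemma grad_omega_le:
  fixes x :: "real^'n"
  shows "(\<Sum>i\<in>UNIV. (sin (x $ i) / 2)\<^sup>2) \<le> \<omega> x - (\<omega> x)\<^sup>2 / CARD('n)"
proof -
  have "(sin (x $ i) / 2)\<^sup>2 = (sin (x $ i / 2))\<^sup>2 - ((sin (x $ i / 2))\<^sup>2)\<^sup>2" for i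
  proof -
    have "(sin (x $ i) / 2)\<^sup>2 = (sin (x $ i / 2))\<^sup>2 * (cos (x $ i / 2))\<^sup>2"
      using sin_double[of "x $ i / 2"] by (simp add: power_mult_distrib)
    then show ?thesis
      by (simp only: cos_squared_eq) (simp add: algebra_simps power2_eq_square)
  qed
  then have "(\<Sum>i\<in>UNIV. (sin (x $ i) / 2)\<^sup>2) = \<omega> x - (\<Sum>i\<in>UNIV. ((sin (x $ i / 2))\<^sup>2)\<^sup>2)"
    by (simp add: \<omega>_def sum_subtractf)
  moreover have "(\<omega> x)\<^sup>2 \<le> CARD('n) * (\<Sum>i\<in>UNIV. ((sin (x $ i / 2))\<^sup>2)\<^sup>2)"
    unfolding \<omega>_def
    using Cauchy_Schwarz_ineq_sum[of "\<lambda>i. 1" "\<lambda>i. (sin (x $ i / 2))\<^sup>2" "UNIV :: 'n set"] by simp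
  then have "(\<omega> x)\<^sup>2 / CARD('n) \<le> (\<Sum>i\<in>UNIV. ((sin (x $ i / 2))\<^sup>2)\<^sup>2)"
    by (simp add: divide_le_eq mult.commute)
  ultimately show ?thesis by linarith
qed

section \<open>The regularized weight and the integrated divergence identity\<close>

lemma omega_eps_pos: "0 < \<epsilon> \<Longrightarrow> 0 < \<omega> x + \<epsilon>"
  using omega_nonneg[of x] by linarith

definition wint :: "real \<Rightarrow> nat \<Rightarrow> (real ^ 'n \<Rightarrow> real) \<Rightarrow> real" where
  "wint \<epsilon> p h = (LINT x|cube. h x / (\<omega> x + \<epsilon>) ^ p)"

lemma continuous_on_weighted:
  assumes "continuous_on UNIV h" "0 < \<epsilon>"
  shows "continuous_on UNIV (\<lambda>x. h x / (\<omega> x + \<epsilon>) ^ p)"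
  using omega_eps_pos[OF assms(2), THEN less_imp_neq, symmetric]
  by (intro continuous_intros assms) auto

text \<open>The integrand is the \<open>i\<close>-th partial derivative of f^2 (sin x_i / 2) / w^p.
  On each line in direction \<open>i\<close> the boundary terms vanish because sin is zero at - pi
  and pi, whatever the values of \<open>f\<close> there.\<close>

lemma integral_divergence_eq_0:
  fixes f :: "real^'n \<Rightarrow> real"
  assumes C1: "cube_C1 f g" and "0 < \<epsilon>"
  defines "w \<equiv> \<lambda>x. \<omega> x + \<epsilon>"
  shows "(LINT x|cube. f x * g i x * sin (x $ i) / w x ^ p + (f x)\<^sup>2 * cos (x $ i) / 2 / w x ^ p
           - p * (f x)\<^sup>2 * (sin (x $ i) / 2)\<^sup>2 / w x ^ Suc p) = 0" (is "integral\<^sup>L cube ?D = 0")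
proof -
  have f: "continuous_on UNIV f" and g: "continuous_on UNIV (g i)"
    using C1 by (auto simp: cube_C1_def)
  have w: "w x \<noteq> 0" for x
    using omega_eps_pos[OF \<open>0 < \<epsilon>\<close>, of x] by (simp add: w_def)
  have cw: "continuous_on S w" for S
    unfolding w_def by (intro continuous_intros)
  have cD: "continuous_on UNIV ?D"
    by (intro continuous_intros f g cw) (auto simp: w)
  have "coord_avg i ?D x = 0" if x: "x \<in> Q" for x
  proof -
    let ?F = "\<lambda>t. (f (upd i x t))\<^sup>2 * (sin t / 2) / w (upd i x t) ^ p"
    have "((\<lambda>t. ?D (upd i x t)) has_integral ?F pi - ?F (- pi)) {- pi..pi}"
    proof (rule fundamental_theorem_of_calculus_interior)
      show "continuous_on {- pi..pi} ?F"
        by (intro continuous_intros continuous_on_compose2[OF f] continuous_on_compose2[OF cw]) (auto simp: w)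
      fix t assume t: "t \<in> {- pi<..<pi}"
      have df: "((\<lambda>t. f (upd i x t)) has_real_derivative g i (upd i x t)) (at t)"
        using C1 x t by (auto simp: cube_C1_def)
      have dw: "((\<lambda>t. w (upd i x t)) has_real_derivative sin t / 2) (at t)"
        unfolding w_def by (auto intro!: derivative_eq_intros has_real_derivative_omega_upd)
      have "((\<lambda>t. 1 / w (upd i x t) ^ p) has_real_derivative
          - (p * (sin t / 2) / w (upd i x t) ^ Suc p)) (at t)"
      \<comment> \<open>The power rule involves the exponent \<open>p - 1\<close>, a truncated
        subtraction; for \<open>p = 0\<close> the function is constant.\<close>
      proof (cases p)
        case (Suc q)
        have "((\<lambda>t. inverse (w (upd i x t))) has_real_derivative
            - (inverse (w (upd i x t)) * (sin t / 2) * inverse (w (upd i x t)))) (at t)"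
          by (rule DERIV_inverse'[OF dw]) (simp add: w)
        from DERIV_power[OF this, of p]
        have "((\<lambda>t. inverse (w (upd i x t)) ^ p) has_real_derivative real p *
            (- (inverse (w (upd i x t)) * (sin t / 2) * inverse (w (upd i x t))) * inverse (w (upd i x t)) ^ q)) (at t)"
          using Suc by simp
        moreover have "r * (- (inverse v * s * inverse v) * inverse v ^ q) = - (r * s / v ^ Suc p)" for r v s :: real
          unfolding Suc power_Suc divide_inverse inverse_mult_distrib power_inverse by simp
        ultimately show ?thesis
          by (simp only: power_one_over[symmetric] inverse_eq_divide)
      qed simp
      moreover have "((\<lambda>t. (f (upd i x t))\<^sup>2 * (sin t / 2)) has_real_derivative
          (2 * f (upd i x t) * g i (upd i x t)) * (sin t / 2) + cos t / 2 * (f (upd i x t))\<^sup>2) (at t)"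
      proof (rule DERIV_mult)
        show "((\<lambda>t. (f (upd i x t))\<^sup>2) has_real_derivative 2 * f (upd i x t) * g i (upd i x t)) (at t)"
          using DERIV_power[OF df, of 2] by (simp add: mult_ac)
        show "((\<lambda>t. sin t / 2) has_real_derivative cos t / 2) (at t)"
          by (auto intro!: derivative_eq_intros)
      qed
      ultimately have "((\<lambda>t. (f (upd i x t))\<^sup>2 * (sin t / 2) * (1 / w (upd i x t) ^ p)) has_real_derivative
         ((2 * f (upd i x t) * g i (upd i x t)) * (sin t / 2) + cos t / 2 * (f (upd i x t))\<^sup>2) * (1 / w (upd i x t) ^ p)
         + - (p * (sin t / 2) / w (upd i x t) ^ Suc p) * ((f (upd i x t))\<^sup>2 * (sin t / 2))) (at t)"
        by (rule DERIV_mult[rotated])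
      also have "((2 * f (upd i x t) * g i (upd i x t)) * (sin t / 2) + cos t / 2 * (f (upd i x t))\<^sup>2) * (1 / w (upd i x t) ^ p)
         + - (p * (sin t / 2) / w (upd i x t) ^ Suc p) * ((f (upd i x t))\<^sup>2 * (sin t / 2)) = ?D (upd i x t)"
      proof -
        have "((2 * a * b) * (s / 2) + c / 2 * a\<^sup>2) * (1 / v) + - (p * (s / 2) / v') * (a\<^sup>2 * (s / 2))
          = a * b * s / v + a\<^sup>2 * c / 2 / v - p * a\<^sup>2 * (s / 2)\<^sup>2 / v'" for a b c s v v' :: real
        proof -
          have "((2 * a * b) * (s / 2) + c / 2 * a\<^sup>2) * V + - (r * (s / 2) * U) * (a\<^sup>2 * (s / 2))
            = a * b * s * V + a\<^sup>2 * c / 2 * V - r * a\<^sup>2 * (s / 2)\<^sup>2 * U" for V U r :: real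
            by (simp add: power2_eq_square ring_distribs mult_ac)
          from this[of "1 / v" p "1 / v'"] show ?thesis by simp
        qed
        then show ?thesis unfolding upd_nth by (simp only: simp_thms if_True)
      qed
      finally show "(?F has_vector_derivative ?D (upd i x t)) (at t)"
        by (simp add: has_real_derivative_iff_has_vector_derivative)
    qed simp
    then show ?thesis by (simp add: coord_avg_def integral_unique)
  qed
  then have "integral\<^sup>L cube (coord_avg i ?D) = integral\<^sup>L cube (\<lambda>x :: real^'n. 0)"
    by (intro Bochner_Integration.integral_cong) auto
  then show ?thesis
    using integral_cube_coord_avg[OF cD] by simp
qed

text \<open>In the applications \<open>s\<^sub>i = \<partial>\<^sub>i\<omega> = sin x\<^sub>i / 2\<close>, \<open>y = \<omega> x\<close>, and \<open>a = d/2 - p\<close>.\<close>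

lemma pointwise_hardy:
  fixes s g :: "'n::finite \<Rightarrow> real"
  defines "d \<equiv> real CARD('n)"
  assumes s: "(\<Sum>i\<in>UNIV. (s i)\<^sup>2) \<le> y - y\<^sup>2 / d" and y: "0 \<le> y" and e: "0 < \<epsilon>"
    and a: "a = d / 2 - p" "0 < a" and p: "0 \<le> p"
  defines "w \<equiv> y + \<epsilon>"
  shows "a / 2 * u\<^sup>2 - (3 * d - 2 * p) / (4 * d) * w * u\<^sup>2 - \<epsilon> * u\<^sup>2 - 2 / a * w * (\<Sum>i\<in>UNIV. (g i)\<^sup>2)
    \<le> 2 * u * (\<Sum>i\<in>UNIV. g i * s i) + u\<^sup>2 * (d / 2 - y) - p * u\<^sup>2 * (\<Sum>i\<in>UNIV. (s i)\<^sup>2) / w"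
proof -
  have w: "0 < w" using y e by (simp add: w_def)
  have d: "0 < d" by (simp add: d_def)
  let ?S = "\<Sum>i\<in>UNIV. (s i)\<^sup>2" and ?G = "\<Sum>i\<in>UNIV. (g i)\<^sup>2"
  \<comment> \<open>The weight in Young's inequality. With X = t / w the leading coefficients are a
    - t for \<open>u\<close> and 1 / t for the gradient; their quotient 1 / (t (a - t)) is least at
    t = a / 2, which produces the value 4 / a^2 of \<open>C1\<close>.\<close>
  define X where "X = a / 2 / w"
  have X: "0 < X" using a w by (simp add: X_def)
  have "0 \<le> X * u\<^sup>2 * (s i)\<^sup>2 + (g i)\<^sup>2 / X + 2 * u * (g i * s i)" for i
  proof -
    have "X * u\<^sup>2 * (s i)\<^sup>2 + (g i)\<^sup>2 / X + 2 * u * (g i * s i) = (X * u * s i + g i)\<^sup>2 / X"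
      using X by (simp add: field_simps power2_eq_square)
    then show ?thesis using X by simp
  qed
  then have "0 \<le> (\<Sum>i\<in>UNIV. X * u\<^sup>2 * (s i)\<^sup>2 + (g i)\<^sup>2 / X + 2 * u * (g i * s i))"
    by (intro sum_nonneg) auto
  also have "\<dots> = X * u\<^sup>2 * ?S + ?G / X + 2 * u * (\<Sum>i\<in>UNIV. g i * s i)"
    by (simp add: sum.distrib sum_distrib_left sum_divide_distrib)
  also have "?G / X = 2 / a * w * ?G"
    using a by (simp add: X_def)
  finally have 1: "- (X * u\<^sup>2 * ?S) - 2 / a * w * ?G \<le> 2 * u * (\<Sum>i\<in>UNIV. g i * s i)"
    by linarith
  \<comment> \<open>Here w (w - 2 \<epsilon>) = y^2 - \<epsilon>^2. The bound in terms of
    \<open>w\<close> has \<open>w\<close> as a factor, so it can be divided by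
    \<open>w\<close>.\<close>
  have "y - y\<^sup>2 / d \<le> w - w * (w - 2 * \<epsilon>) / d"
  proof -
    have "w * (w - 2 * \<epsilon>) \<le> y\<^sup>2" by (simp add: w_def power2_eq_square algebra_simps)
    then have "w * (w - 2 * \<epsilon>) / d \<le> y\<^sup>2 / d" using d by (intro divide_right_mono) auto
    then show ?thesis using e by (simp add: w_def)
  qed
  with s have "?S \<le> w * (1 - (w - 2 * \<epsilon>) / d)" by (simp add: algebra_simps)
  then have S: "?S / w \<le> 1 - (w - 2 * \<epsilon>) / d" using w by (simp add: field_simps)
  have "(p + a / 2) * (?S / w) \<le> (p + a / 2) * (1 - (w - 2 * \<epsilon>) / d)"
    using a p by (intro mult_left_mono S) auto
  also have "\<dots> = p + a / 2 - w * ((p + a / 2) / d) + \<epsilon> * (2 * (p + a / 2) / d)"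
    using d by (simp add: field_simps)
  \<comment> \<open>Since a = d / 2 - p is positive, 2 p + a = d / 2 + p is less than d.\<close>
  also have "\<dots> \<le> p + a / 2 - w * ((p + a / 2) / d) + \<epsilon> * 1"
    using a p d e by (intro add_mono mult_left_mono order_refl) (auto simp: field_simps)
  finally have S': "(p + a / 2) * (?S / w) \<le> p + a / 2 - w * ((p + a / 2) / d) + \<epsilon> * 1" .
  then have "a / 2 - (3 * d - 2 * p) / (4 * d) * w - \<epsilon> \<le> d / 2 - y - (p + a / 2) * (?S / w)"
  proof -
    \<comment> \<open>This is p + a / 2 = d / 4 + p / 2, the total coefficient of the gradient of
      \<omega>: p comes from differentiating the weight and a / 2 from Young's inequality.\<close>
    have "(3 * d - 2 * p) / (4 * d) = 1 - (p + a / 2) / d"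
    proof -
      have "3 * d - 2 * p = 4 * (d - (p + a / 2))" using a by (simp add: field_simps)
      then show ?thesis using d by (simp only: mult_divide_mult_cancel_left_if) (simp add: diff_divide_distrib)
    qed
    moreover have "y \<le> w" using e by (simp add: w_def)
    moreover have "d / 2 = a + p" using a by simp
    ultimately show ?thesis
      using S' by (simp only: left_diff_distrib right_diff_distrib mult_1 mult_1_right mult.commute[of _ w])
  qed
  then have "(a / 2 - (3 * d - 2 * p) / (4 * d) * w - \<epsilon>) * u\<^sup>2 \<le> (d / 2 - y - (p + a / 2) * (?S / w)) * u\<^sup>2"
    by (intro mult_right_mono) auto
  also have "(a / 2 - (3 * d - 2 * p) / (4 * d) * w - \<epsilon>) * u\<^sup>2
      = a / 2 * u\<^sup>2 - (3 * d - 2 * p) / (4 * d) * w * u\<^sup>2 - \<epsilon> * u\<^sup>2"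
    by (simp only: left_diff_distrib)
  also have "(d / 2 - y - (p + a / 2) * (?S / w)) * u\<^sup>2
      = u\<^sup>2 * (d / 2 - y) - p * u\<^sup>2 * ?S / w - X * u\<^sup>2 * ?S"
  proof -
    have "X * u\<^sup>2 * ?S = a / 2 * (?S / w) * u\<^sup>2" by (simp add: X_def)
    moreover have "p * u\<^sup>2 * ?S / w = p * (?S / w) * u\<^sup>2" by simp
    moreover have "(d / 2 - y - (p + a / 2) * z) * v = v * (d / 2 - y) - p * z * v - a / 2 * z * v" for z v
      by (simp only: left_diff_distrib right_diff_distrib distrib_right mult.commute[of v])
    ultimately show ?thesis by (simp only:)
  qed
  finally show ?thesis using 1 by linarith
qed

text \<open>\<open>pointwise_hardy\<close> with exponent \<open>Suc q\<close> is divided by the same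
  power of the weight and integrated; its right-hand side becomes a divergence, with integral zero.
  The term with factor \<epsilon> is the price of the regularization.\<close>

lemma regularized_hardy:
  fixes f :: "real^'n \<Rightarrow> real"
  defines "d \<equiv> real CARD('n)"
  assumes C1: "cube_C1 f g" and e: "0 < \<epsilon>" and p: "2 * real (Suc q) < d"
    and a: "a = d / 2 - real (Suc q)"
  shows "a / 2 * wint \<epsilon> (Suc q) (\<lambda>x. (f x)\<^sup>2)
     \<le> (3 * d - 2 * real (Suc q)) / (4 * d) * wint \<epsilon> q (\<lambda>x. (f x)\<^sup>2)
       + 2 / a * wint \<epsilon> q (\<lambda>x. \<Sum>i\<in>UNIV. (g i x)\<^sup>2) + \<epsilon> * wint \<epsilon> (Suc q) (\<lambda>x. (f x)\<^sup>2)"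
proof -
  let ?p = "real (Suc q)" and ?w = "\<lambda>x :: real^'n. \<omega> x + \<epsilon>"
  let ?c = "(3 * d - 2 * ?p) / (4 * d)"
  let ?D = "\<lambda>i x. f x * g i x * sin (x $ i) / ?w x ^ Suc q + (f x)\<^sup>2 * cos (x $ i) / 2 / ?w x ^ Suc q
           - ?p * (f x)\<^sup>2 * (sin (x $ i) / 2)\<^sup>2 / ?w x ^ Suc (Suc q)"
  let ?L = "\<lambda>x. a / 2 * ((f x)\<^sup>2 / ?w x ^ Suc q) - ?c * ((f x)\<^sup>2 / ?w x ^ q) - \<epsilon> * ((f x)\<^sup>2 / ?w x ^ Suc q)
        - 2 / a * ((\<Sum>i\<in>UNIV. (g i x)\<^sup>2) / ?w x ^ q)"
  have f: "continuous_on UNIV f" and g: "continuous_on UNIV (g i)" for i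
    using C1 by (auto simp: cube_C1_def)
  have w: "0 < ?w x" for x by (rule omega_eps_pos[OF e])
  have iD: "integrable cube (?D i)" for i
    using w by (intro integrable_cube continuous_intros f g) (auto simp: less_imp_neq[symmetric])
  have int: "integrable cube (\<lambda>x. (f x)\<^sup>2 / ?w x ^ r)" "integrable cube (\<lambda>x. (\<Sum>i\<in>UNIV. (g i x)\<^sup>2) / ?w x ^ r)" for r
    by (intro integrable_cube continuous_on_weighted continuous_intros f g e)+
  have le: "?L x \<le> (\<Sum>i\<in>UNIV. ?D i x)" for x
  proof -
    let ?S = "\<Sum>i\<in>UNIV. (sin (x $ i) / 2)\<^sup>2"
    have a': "a = real CARD('n) / 2 - ?p" "0 < a" "0 \<le> ?p"
      using a p by (simp_all add: d_def)
    have "(a / 2 * (f x)\<^sup>2 - ?c * ?w x * (f x)\<^sup>2 - \<epsilon> * (f x)\<^sup>2 - 2 / a * ?w x * (\<Sum>i\<in>UNIV. (g i x)\<^sup>2)) / ?w x ^ Suc q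
       \<le> (2 * f x * (\<Sum>i\<in>UNIV. g i x * (sin (x $ i) / 2)) + (f x)\<^sup>2 * (d / 2 - \<omega> x) - ?p * (f x)\<^sup>2 * ?S / ?w x) / ?w x ^ Suc q"
      using w[of x] unfolding d_def
      by (intro divide_right_mono pointwise_hardy grad_omega_le omega_nonneg e a') auto
    also have "\<dots> = (\<Sum>i\<in>UNIV. ?D i x)"
    proof -
      have "(\<Sum>i\<in>UNIV. ?D i x) = (2 * f x * (\<Sum>i\<in>UNIV. g i x * (sin (x $ i) / 2))) / ?w x ^ Suc q
          + (f x)\<^sup>2 * ((\<Sum>i\<in>UNIV. cos (x $ i)) / 2) / ?w x ^ Suc q - (?p * (f x)\<^sup>2 * ?S / ?w x) / ?w x ^ Suc q"
        by (simp add: sum.distrib sum_subtractf sum_distrib_left sum_divide_distrib mult_ac)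
      also have "(\<Sum>i\<in>UNIV. cos (x $ i)) / 2 = d / 2 - \<omega> x"
        by (simp add: sum_cos_eq_omega d_def)
      finally show ?thesis by (simp only: add_divide_distrib diff_divide_distrib)
    qed
    also have "(a / 2 * (f x)\<^sup>2 - ?c * ?w x * (f x)\<^sup>2 - \<epsilon> * (f x)\<^sup>2 - 2 / a * ?w x * (\<Sum>i\<in>UNIV. (g i x)\<^sup>2)) / ?w x ^ Suc q = ?L x"
    proof -
      have "?w x * b / ?w x ^ Suc q = b / ?w x ^ q" for b
        using w[of x] by simp
      then show ?thesis
        by (simp only: diff_divide_distrib mult.assoc times_divide_eq_right[symmetric])
    qed
    finally show ?thesis .
  qed
  have "integral\<^sup>L cube ?L \<le> (LINT x|cube. (\<Sum>i\<in>UNIV. ?D i x))"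
    by (intro integral_mono le Bochner_Integration.integrable_diff Bochner_Integration.integrable_sum
        integrable_mult_right int iD)
  also have "\<dots> = (\<Sum>i\<in>UNIV. integral\<^sup>L cube (?D i))"
    by (intro Bochner_Integration.integral_sum iD)
  also have "\<dots> = 0"
    using integral_divergence_eq_0[OF C1 e, where p = "Suc q"] by (intro sum.neutral) simp
  finally have "integral\<^sup>L cube ?L \<le> 0" .
  moreover have "integral\<^sup>L cube ?L = a / 2 * wint \<epsilon> (Suc q) (\<lambda>x. (f x)\<^sup>2) - ?c * wint \<epsilon> q (\<lambda>x. (f x)\<^sup>2)
      - \<epsilon> * wint \<epsilon> (Suc q) (\<lambda>x. (f x)\<^sup>2) - 2 / a * wint \<epsilon> q (\<lambda>x. \<Sum>i\<in>UNIV. (g i x)\<^sup>2)"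
    unfolding wint_def
    by (simp only: Bochner_Integration.integral_diff integral_mult_right_zero
        Bochner_Integration.integrable_diff integrable_mult_right int)
  ultimately show ?thesis by linarith
qed

subsection \<open>Removing the regularization\<close>

text \<open>Induction through \<open>regularized_hardy\<close> for the constant function 1, whose
  gradient term is absent. For \<epsilon> below a / 4 the error term is absorbed by half of the
  left-hand side, leaving a bound uniform in \<epsilon>.\<close>

lemma wint_inverse_omega_bounded:
  assumes "2 * real p < CARD('n)"
  shows "\<exists>B. \<exists>\<delta>>0. \<forall>\<epsilon>. 0 < \<epsilon> \<and> \<epsilon> < \<delta> \<longrightarrow> wint \<epsilon> p (\<lambda>x :: real^'n. 1) \<le> B"
  using assms
proof (induction p)
  case 0
  show ?case by (rule exI[of _ "wint 0 0 (\<lambda>x :: real^'n. 1)"], rule exI[of _ 1]) (simp add: wint_def)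
next
  case (Suc q)
  define d where "d = real CARD('n)"
  define a where "a = d / 2 - real (Suc q)"
  define c where "c = (3 * d - 2 * real (Suc q)) / (4 * d)"
  have a: "0 < a" using Suc.prems by (simp add: a_def d_def)
  have c: "0 \<le> c" using Suc.prems by (simp add: c_def d_def)
  obtain B \<delta> where B: "0 < \<delta>" "\<And>\<epsilon>. 0 < \<epsilon> \<Longrightarrow> \<epsilon> < \<delta> \<Longrightarrow> wint \<epsilon> q (\<lambda>x :: real^'n. 1) \<le> B"
    using Suc by auto
  have C1: "cube_C1 (\<lambda>x :: real^'n. 1) (\<lambda>i x. 0)"
    by (simp add: cube_C1_def)
  show ?case
  proof (rule exI[of _ "4 / a * (c * B)"], rule exI[of _ "min \<delta> (a / 4)"], intro conjI allI impI)
    show "0 < min \<delta> (a / 4)" using B a by simp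
    fix \<epsilon> assume e: "0 < \<epsilon> \<and> \<epsilon> < min \<delta> (a / 4)"
    let ?A = "wint \<epsilon> (Suc q) (\<lambda>x :: real^'n. 1)"
    have "?A \<ge> 0"
      unfolding wint_def using e omega_nonneg by (intro integral_nonneg_AE) (auto simp: omega_nonneg)
    have "a / 2 * ?A \<le> c * wint \<epsilon> q (\<lambda>x :: real^'n. 1) + \<epsilon> * ?A"
      using regularized_hardy[OF C1, of \<epsilon> q a] e Suc.prems
      by (simp add: a_def c_def d_def wint_def)
    also have "\<dots> \<le> c * B + a / 4 * ?A"
      using e B c \<open>?A \<ge> 0\<close> by (intro add_mono mult_left_mono mult_right_mono) auto
    finally have "a / 4 * ?A \<le> c * B" by linarith
    then show "?A \<le> 4 / a * (c * B)" using a by (simp add: field_simps)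
  qed
qed

lemma tendsto_weight:
  assumes "0 < y"
  shows "(\<lambda>n. b / (y + 1 / real (Suc n)) ^ p) \<longlonglongrightarrow> b / y ^ p"
proof -
  have "(\<lambda>n. b / (y + 1 / real (Suc n)) ^ p) \<longlonglongrightarrow> b / (y + 0) ^ p"
    using LIMSEQ_inverse_real_of_nat assms by (intro tendsto_intros) (auto simp: inverse_eq_divide)
  then show ?thesis by simp
qed

lemma borel_measurable_weighted:
  fixes h :: "real^'n \<Rightarrow> real"
  assumes "continuous_on UNIV h"
  shows "(\<lambda>x. h x / (\<omega> x + \<epsilon>) ^ p) \<in> borel_measurable cube"
proof -
  have [measurable]: "h \<in> borel_measurable borel" "(\<omega> :: real^'n \<Rightarrow> real) \<in> borel_measurable borel"
    using assms continuous_on_omega by (auto intro: borel_measurable_continuous_onI)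
  show ?thesis by (intro borel_measurable_cube) measurable
qed

text \<open>Fatou's lemma along \<epsilon> = 1 / (n + 1) turns the uniform bound into integrability
  of the singular weight.\<close>

lemma integrable_inverse_omega:
  assumes "2 * real p < CARD('n)"
  shows "integrable cube (\<lambda>x :: real^'n. 1 / \<omega> x ^ p)"
proof -
  let ?u = "\<lambda>n x :: real^'n. 1 / (\<omega> x + 1 / real (Suc n)) ^ p"
  obtain B \<delta> where \<delta>: "0 < \<delta>" and B: "\<And>\<epsilon>. 0 < \<epsilon> \<Longrightarrow> \<epsilon> < \<delta> \<Longrightarrow> wint \<epsilon> p (\<lambda>x :: real^'n. 1) \<le> B"
    using wint_inverse_omega_bounded[OF assms] by blast
  have u0: "0 \<le> ?u n x" for n x using omega_nonneg[of x] by simp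
  have "(\<integral>\<^sup>+x. ennreal (norm (1 / \<omega> (x :: real^'n) ^ p)) \<partial>cube) = (\<integral>\<^sup>+x. liminf (\<lambda>n. ennreal (?u n x)) \<partial>cube)"
  proof (rule nn_integral_cong_AE, use AE_omega_pos in eventually_elim)
    fix x :: "real^'n" assume "0 < \<omega> x"
    then have "(\<lambda>n. ennreal (?u n x)) \<longlonglongrightarrow> ennreal (1 / \<omega> x ^ p)"
      by (intro tendsto_ennrealI tendsto_weight)
    then have "liminf (\<lambda>n. ennreal (?u n x)) = ennreal (1 / \<omega> x ^ p)"
      by (rule lim_imp_Liminf[OF trivial_limit_sequentially])
    also have "1 / \<omega> x ^ p = norm (1 / \<omega> x ^ p)"
      using \<open>0 < \<omega> x\<close> by simp
    finally show "ennreal (norm (1 / \<omega> x ^ p)) = liminf (\<lambda>n. ennreal (?u n x))" ..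
  qed
  also have "\<dots> \<le> liminf (\<lambda>n. \<integral>\<^sup>+x. ennreal (?u n x) \<partial>cube)"
    by (intro nn_integral_liminf measurable_compose[OF borel_measurable_weighted measurable_ennreal]) auto
  also have "\<dots> \<le> ennreal B"
  proof -
    have "\<forall>\<^sub>F n in sequentially. 1 / real (Suc n) < \<delta>"
      using order_tendstoD(2)[OF LIMSEQ_inverse_real_of_nat \<delta>] by (simp add: inverse_eq_divide)
    then have "\<forall>\<^sub>F n in sequentially. (\<integral>\<^sup>+x. ennreal (?u n x) \<partial>cube) \<le> ennreal B"
    proof eventually_elim
      case (elim n)
      have "(\<integral>\<^sup>+x. ennreal (?u n x) \<partial>cube) = ennreal (wint (1 / real (Suc n)) p (\<lambda>x :: real^'n. 1))"
        unfolding wint_def using u0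
        by (intro nn_integral_eq_integral integrable_cube continuous_on_weighted) auto
      then show ?case using B elim by (auto intro: ennreal_leI)
    qed
    then show ?thesis
      by (intro Liminf_le) auto
  qed
  also have "\<dots> < \<infinity>" by simp
  finally show ?thesis
    using borel_measurable_weighted[of "\<lambda>x. 1" 0] by (intro integrableI_bounded) auto
qed

text \<open>\<open>h\<close> is bounded on the cube, so a multiple of the integrable singular weight
  dominates all the regularized integrands.\<close>

lemma integrable_weighted:
  fixes h :: "real^'n \<Rightarrow> real"
  assumes h: "continuous_on UNIV h" and p: "2 * real p < CARD('n)"
  shows "integrable cube (\<lambda>x. h x / \<omega> x ^ p)"
    and "(\<lambda>n. wint (1 / real (Suc n)) p h) \<longlonglongrightarrow> wint 0 p h"
proof -
  obtain B where B: "0 \<le> B" "\<And>x. x \<in> Q \<Longrightarrow> \<bar>h x\<bar> \<le> B" using bounded_on_Q[OF h] by blast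
  have int: "integrable cube (\<lambda>x :: real^'n. B * (1 / \<omega> x ^ p))"
    by (intro integrable_mult_right integrable_inverse_omega p)
  have le: "\<bar>h x / (\<omega> x + \<epsilon>) ^ p\<bar> \<le> B * (1 / \<omega> x ^ p)" if "x \<in> Q" "0 < \<omega> x" "0 \<le> \<epsilon>" for x \<epsilon>
  proof -
    have "\<omega> x ^ p \<le> (\<omega> x + \<epsilon>) ^ p" using that by (intro power_mono) auto
    then show ?thesis
      using that B by (auto simp: abs_mult intro!: frac_le)
  qed
  have AE_Q: "AE x in cube. x \<in> (Q :: (real^'n) set)"
    by (rule AE_I2) simp
  show "integrable cube (\<lambda>x. h x / \<omega> x ^ p)"
  proof (rule Bochner_Integration.integrable_bound[OF int])
    show "(\<lambda>x. h x / \<omega> x ^ p) \<in> borel_measurable cube"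
      using borel_measurable_weighted[OF h, of 0] by simp
    show "AE x in cube. norm (h x / \<omega> x ^ p) \<le> norm (B * (1 / \<omega> x ^ p))"
      using AE_omega_pos AE_Q
    proof eventually_elim
      case (elim x)
      then show ?case using le[of x 0] B by simp
    qed
  qed
  show "(\<lambda>n. wint (1 / real (Suc n)) p h) \<longlonglongrightarrow> wint 0 p h"
    unfolding wint_def
  proof (rule integral_dominated_convergence[OF _ _ int])
    show "AE x in cube. (\<lambda>n. h x / (\<omega> x + 1 / real (Suc n)) ^ p) \<longlonglongrightarrow> h x / (\<omega> x + 0) ^ p"
      using AE_omega_pos by eventually_elim (simp only: add_0_right tendsto_weight)
    show "AE x in cube. norm (h x / (\<omega> x + 1 / real (Suc n)) ^ p) \<le> B * (1 / \<omega> x ^ p)" for n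
      using AE_omega_pos AE_Q by eventually_elim (use le in auto)
  qed (rule borel_measurable_weighted[OF h])+
qed

section \<open>Recursion in the exponent of the weight\<close>

lemma wint_0: "wint 0 p h = (LINT x|cube. h x / \<omega> x ^ p)"
  by (simp add: wint_def)

text \<open>Limit of \<open>regularized_hardy\<close> as \<epsilon> tends to 0: the integral
  multiplied by \<epsilon> converges to a finite value, so the error disappears.\<close>

lemma hardy_step:
  fixes f :: "real^'n \<Rightarrow> real"
  assumes C1: "cube_C1 f g" and q: "2 * real (Suc q) < CARD('n)"
  shows "wint 0 (Suc q) (\<lambda>x. (f x)\<^sup>2) \<le> C1 (- int q) CARD('n) * wint 0 q (\<lambda>x. \<Sum>i\<in>UNIV. (g i x)\<^sup>2)
     + C2 (- int q) CARD('n) * wint 0 q (\<lambda>x. (f x)\<^sup>2)"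
proof -
  define d where "d = real CARD('n)"
  define a where "a = d / 2 - real (Suc q)"
  define c where "c = (3 * d - 2 * real (Suc q)) / (4 * d)"
  have a: "0 < a" using q by (simp add: a_def d_def)
  have d: "0 < d" by (simp add: d_def)
  have f: "continuous_on UNIV (\<lambda>x. (f x)\<^sup>2)" and g: "continuous_on UNIV (\<lambda>x. \<Sum>i\<in>UNIV. (g i x)\<^sup>2)"
    using C1 by (auto simp: cube_C1_def intro!: continuous_intros)
  let ?f = "\<lambda>x. (f x)\<^sup>2" and ?g = "\<lambda>x. \<Sum>i\<in>UNIV. (g i x)\<^sup>2"
  have q': "2 * real q < CARD('n)" using q by simp
  have "a / 2 * wint 0 (Suc q) ?f \<le> c * wint 0 q ?f + 2 / a * wint 0 q ?g + 0 * wint 0 (Suc q) ?f"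
  proof (rule LIMSEQ_le)
    show "(\<lambda>n. a / 2 * wint (1 / real (Suc n)) (Suc q) ?f) \<longlonglongrightarrow> a / 2 * wint 0 (Suc q) ?f"
      by (intro tendsto_intros integrable_weighted f q)
    show "(\<lambda>n. c * wint (1 / real (Suc n)) q ?f + 2 / a * wint (1 / real (Suc n)) q ?g
        + 1 / real (Suc n) * wint (1 / real (Suc n)) (Suc q) ?f)
      \<longlonglongrightarrow> c * wint 0 q ?f + 2 / a * wint 0 q ?g + 0 * wint 0 (Suc q) ?f"
      using LIMSEQ_inverse_real_of_nat
      by (intro tendsto_intros integrable_weighted f g q q') (simp add: inverse_eq_divide)
    show "\<exists>N. \<forall>n\<ge>N. a / 2 * wint (1 / real (Suc n)) (Suc q) ?f \<le>
        c * wint (1 / real (Suc n)) q ?f + 2 / a * wint (1 / real (Suc n)) q ?g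
        + 1 / real (Suc n) * wint (1 / real (Suc n)) (Suc q) ?f"
      using q unfolding c_def d_def
      by (intro exI[of _ 0] allI impI regularized_hardy[OF C1]) (auto simp: a_def d_def)
  qed
  then have "wint 0 (Suc q) ?f \<le> 2 / a * (c * wint 0 q ?f + 2 / a * wint 0 q ?g)"
    using a by (simp add: field_simps)
  \<comment> \<open>For k = - q the denominators in \<open>C1\<close> and \<open>C2\<close> are
    built from d + 2 k - 2 = 2 a. The constants become 4 / a^2 and 2 c / a, as obtained by dividing
    by a / 2.\<close>
  moreover have da: "d + 2 * of_int (- int q) - 2 = 2 * a"
    by (simp add: a_def)
  have "C1 (- int q) CARD('n) = 2 / a * (2 / a)"
    unfolding C1_def d_def[symmetric] da by (simp add: power2_eq_square)
  moreover have "C2 (- int q) CARD('n) = 2 / a * c"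
  proof -
    have "3 * d + 2 * of_int (- int q) - 2 = 3 * d - 2 * real (Suc q)" by simp
    then show ?thesis
      unfolding C2_def d_def[symmetric] da c_def using a d by (simp add: field_simps)
  qed
  ultimately show ?thesis by (simp add: algebra_simps)
qed

text \<open>One factor \<omega> is bounded by the dimension. This is the source of the powers of d
  in \<open>H\<close>.\<close>

lemma wint_le_card_mult:
  fixes h :: "real^'n \<Rightarrow> real"
  assumes h: "continuous_on UNIV h" "\<And>x. 0 \<le> h x" and q: "2 * real (Suc q) < CARD('n)"
  shows "wint 0 q h \<le> CARD('n) * wint 0 (Suc q) h"
proof -
  have "wint 0 q h \<le> (LINT x|cube. CARD('n) * (h x / \<omega> x ^ Suc q))"
    unfolding wint_0
  proof (rule integral_mono_AE)
    show "integrable cube (\<lambda>x. h x / \<omega> x ^ q)"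
      using q by (intro integrable_weighted h) auto
    show "integrable cube (\<lambda>x. CARD('n) * (h x / \<omega> x ^ Suc q))"
      by (intro integrable_mult_right integrable_weighted h q)
    show "AE x in cube. h x / \<omega> x ^ q \<le> CARD('n) * (h x / \<omega> x ^ Suc q)"
      using AE_omega_pos
    proof eventually_elim
      case (elim x)
      have "h x / \<omega> x ^ q = \<omega> x * (h x / \<omega> x ^ Suc q)" using elim by simp
      also have "\<dots> \<le> CARD('n) * (h x / \<omega> x ^ Suc q)"
        using elim h(2)[of x] by (intro mult_right_mono omega_le_card) auto
      finally show ?case .
    qed
  qed
  then show ?thesis by (simp only: wint_0 integral_mult_right_zero)
qed

text \<open>The defining sum is read in Horner form: the term j = 0 is split off, and the common
  factor d \<open>C2\<close> is taken out of the remaining terms and of the final product. What is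
  left belongs to the next larger k.\<close>

lemma inverse_H_Suc:
  "inverse (H (- int (Suc n)) d) = C1 (- int (Suc n)) d + C2 (- int (Suc n)) d * (d * inverse (H (- int n) d))"
proof -
  have 1: "(\<Prod>i<Suc j. C2 (- int (Suc n) + int i) d) = C2 (- int (Suc n)) d * (\<Prod>i<j. C2 (- int n + int i) d)" for j
    by (subst prod.lessThan_Suc_shift) simp
  have 2: "(\<Sum>j=0..Suc n. real d ^ j * C1 (- int (Suc n) + int j) d * (\<Prod>i<j. C2 (- int (Suc n) + int i) d))
    = C1 (- int (Suc n)) d + C2 (- int (Suc n)) d * d *
      (\<Sum>j=0..n. real d ^ j * C1 (- int n + int j) d * (\<Prod>i<j. C2 (- int n + int i) d))"
    by (subst sum.atLeast0_atMost_Suc_shift, unfold o_def 1) (simp add: sum_distrib_left mult_ac)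
  show ?thesis
    unfolding H_def inverse_inverse_eq nat_minus_as_int minus_minus nat_int 2
    by (simp only: atLeast0AtMost lessThan_Suc_atMost[symmetric] 1) (simp add: algebra_simps)
qed

lemma C1_pos: "2 * real (Suc n) < d \<Longrightarrow> 0 < C1 (- int n) d"
  by (simp add: C1_def)

lemma C2_pos: "2 * real (Suc n) < d \<Longrightarrow> 0 < C2 (- int n) d"
  by (simp add: C2_def)

lemma inverse_H_pos: "2 * real (Suc n) < d \<Longrightarrow> 0 < inverse (H (- int n) d)"
proof (induction n)
  case 0
  then show ?case using C1_pos[of 0 d] C2_pos[of 0 d] by (simp add: H_def)
next
  case (Suc n)
  then show ?case
    unfolding inverse_H_Suc using C1_pos[of "Suc n" d] C2_pos[of "Suc n" d]
    by (intro add_pos_pos mult_pos_pos) auto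
qed

text \<open>The induction follows \<open>inverse_H_Suc\<close>. \<open>hardy_step\<close> leaves a
  term without derivatives and with a weaker weight; the induction hypothesis bounds it, or for
  \<open>n = 0\<close>, where that weight is 1, the Poincare inequality.\<close>

lemma weighted_hardy:
  fixes f :: "real^'n \<Rightarrow> real"
  assumes C1: "cube_C1 f g"
    and per: "\<And>i x. x \<in> Q \<Longrightarrow> f (upd i x (- pi)) = f (upd i x pi)"
    and mean: "(LINT x|cube. f x) = 0"
    and "2 * real (Suc n) < CARD('n)"
  shows "wint 0 (Suc n) (\<lambda>x. (f x)\<^sup>2) \<le> inverse (H (- int n) CARD('n)) * wint 0 n (\<lambda>x. \<Sum>i\<in>UNIV. (g i x)\<^sup>2)"
  using assms(4)
proof (induction n)
  case 0
  have "wint 0 0 (\<lambda>x. (f x)\<^sup>2) \<le> wint 0 0 (\<lambda>x. \<Sum>i\<in>UNIV. (g i x)\<^sup>2)"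
    using poincare_cube[OF C1 per mean] by (simp add: wint_0)
  then have "C2 0 CARD('n) * wint 0 0 (\<lambda>x. (f x)\<^sup>2) \<le> C2 0 CARD('n) * wint 0 0 (\<lambda>x. \<Sum>i\<in>UNIV. (g i x)\<^sup>2)"
    using C2_pos[of 0 "CARD('n)"] 0 by (intro mult_left_mono) auto
  moreover have "inverse (H 0 CARD('n)) = C1 0 CARD('n) + C2 0 CARD('n)"
    by (simp add: H_def)
  ultimately show ?case
    using hardy_step[OF C1, of 0] 0 by (simp add: algebra_simps)
next
  case (Suc n)
  let ?G = "\<lambda>n. wint 0 n (\<lambda>x. \<Sum>i\<in>UNIV. (g i x)\<^sup>2)" and ?K = "inverse (H (- int n) CARD('n))"
  let ?C2 = "C2 (- int (Suc n)) CARD('n)"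
  have g: "continuous_on UNIV (\<lambda>x. \<Sum>i\<in>UNIV. (g i x)\<^sup>2)"
    using C1 by (auto simp: cube_C1_def intro!: continuous_intros)
  have "wint 0 (Suc n) (\<lambda>x. (f x)\<^sup>2) \<le> ?K * ?G n"
    using Suc by simp
  also have "\<dots> \<le> ?K * (CARD('n) * ?G (Suc n))"
    using Suc.prems by (intro mult_left_mono wint_le_card_mult g less_imp_le[OF inverse_H_pos] sum_nonneg) auto
  finally have "?C2 * wint 0 (Suc n) (\<lambda>x. (f x)\<^sup>2) \<le> ?C2 * (?K * (CARD('n) * ?G (Suc n)))"
    using Suc.prems by (intro mult_left_mono less_imp_le[OF C2_pos])
  then show ?case
    using hardy_step[OF C1 Suc.prems] unfolding inverse_H_Suc by (simp add: algebra_simps)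
qed

subsection \<open>Complex-valued functions\<close>

text \<open>Composition with this retraction onto the closed cube extends a function continuous
  there to a continuous function on the whole space, as \<open>cube_C1\<close> demands.\<close>

definition clamp_Q :: "real ^ 'n \<Rightarrow> real ^ 'n" where
  "clamp_Q = clamp (\<chi> i. - pi) (\<chi> i. pi)"

lemma clamp_Q_id: "x \<in> closure Q \<Longrightarrow> clamp_Q x = x"
  by (simp add: clamp_Q_def closure_Q)

lemma clamp_Q_Q: "x \<in> Q \<Longrightarrow> clamp_Q x = x"
  using closure_subset[of Q] by (auto intro: clamp_Q_id)

lemma continuous_on_clamp_Q:
  fixes h :: "real^'n \<Rightarrow> 'b::metric_space"
  assumes "continuous_on (closure Q) h"
  shows "continuous_on UNIV (\<lambda>x. h (clamp_Q x))"
  unfolding clamp_Q_def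
  by (rule clamp_continuous_on) (use assms in \<open>auto simp: closure_Q\<close>)

lemma has_vector_derivative_upd:
  fixes \<psi> :: "real^'n \<Rightarrow> complex"
  assumes "(\<lambda>s. \<psi> (upd i x t + s *\<^sub>R axis i 1)) differentiable (at 0)"
  shows "((\<lambda>t. \<psi> (upd i x t)) has_vector_derivative partial_deriv i \<psi> (upd i x t)) (at t)"
proof -
  let ?y = "upd i x t"
  have "((\<lambda>s. \<psi> (?y + s *\<^sub>R axis i 1)) has_vector_derivative partial_deriv i \<psi> ?y) (at (t - t))"
    unfolding partial_deriv_def using assms by (simp add: vector_derivative_works)
  then have "((\<lambda>s. \<psi> (?y + s *\<^sub>R axis i 1)) \<circ> (\<lambda>r. r - t) has_vector_derivative 1 *\<^sub>R partial_deriv i \<psi> ?y) (at t)"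
    by (intro vector_diff_chain_at) (auto intro!: derivative_eq_intros)
  moreover have "?y + (r - t) *\<^sub>R axis i 1 = upd i x r" for r
    by (simp add: vec_eq_iff axis_def)
  ultimately show ?thesis by (simp add: o_def)
qed

text \<open>Near an interior parameter the line stays in the open cube, where clamping is the
  identity and \<open>G\<close> agrees with the partial derivative.\<close>

lemma has_vector_derivative_clamp_Q:
  fixes \<psi> :: "real^'n \<Rightarrow> complex"
  assumes "smooth_closure Q \<psi>" "continuous_extension Q (partial_deriv i \<psi>) G"
    and "x \<in> Q" "- pi < t" "t < pi"
  shows "((\<lambda>t. \<psi> (clamp_Q (upd i x t))) has_vector_derivative G (clamp_Q (upd i x t))) (at t)"
proof -
  let ?y = "upd i x t"
  have y: "?y \<in> Q" using assms by (intro upd_mem_Q)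
  have "(\<lambda>s. iter_partial_deriv [] \<psi> (?y + s *\<^sub>R axis i 1)) differentiable (at 0)"
    using assms(1) y unfolding smooth_closure_def by blast
  then have "((\<lambda>t. \<psi> (upd i x t)) has_vector_derivative partial_deriv i \<psi> ?y) (at t)"
    by (intro has_vector_derivative_upd) simp
  then have "((\<lambda>t. \<psi> (clamp_Q (upd i x t))) has_vector_derivative partial_deriv i \<psi> ?y) (at t)"
  proof (rule has_vector_derivative_transform_within_open)
    show "open {- pi<..<pi}" "t \<in> {- pi<..<pi}" using assms by auto
    show "\<psi> (upd i x r) = \<psi> (clamp_Q (upd i x r))" if "r \<in> {- pi<..<pi}" for r
      using that assms by (simp add: clamp_Q_Q upd_mem_Q)
  qed
  moreover have "partial_deriv i \<psi> ?y = G (clamp_Q ?y)"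
    using assms(2) y by (simp add: continuous_extension_def clamp_Q_Q)
  ultimately show ?thesis by simp
qed

lemma omega_powi: "c * \<omega> x powi (- int p) = c / \<omega> x ^ p"
  by (simp add: power_int_minus divide_inverse)

theorem theorem3p4:
  fixes k :: int and \<psi> :: "real ^ 'n \<Rightarrow> complex"
  assumes "k \<le> 0"
    and "int CARD('n) > - 2 * k + 2"
    and "smooth_closure Q \<psi>"
    and "all_derivs_periodic \<psi>"
    and "(LINT x:Q|lborel. \<psi> x) = 0"
  shows "H k CARD('n) * (LINT x:Q|lborel. (cmod (\<psi> x))\<^sup>2 * \<omega> x powi (k - 1))
           \<le> (LINT x:Q|lborel. grad_norm_sq \<psi> x * \<omega> x powi k)"
proof -
  obtain n where k: "k = - int n"
    using assms(1) by (metis int_nat_eq minus_minus neg_0_le_iff_le nat_0_le)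
  \<comment> \<open>The dimension hypothesis is positivity of a = d / 2 - p for the exponent p = n +
    1 = 1 - k.\<close>
  have n: "2 * real (Suc n) < CARD('n)"
  proof -
    have "2 * Suc n < CARD('n)"
      using assms(2) unfolding k by simp
    then have "real (2 * Suc n) < real CARD('n)"
      by (simp only: of_nat_less_iff)
    then show ?thesis by simp
  qed
  have n': "2 * real n < CARD('n)" using n by simp
  have c\<psi>: "continuous_on (closure Q) \<psi>"
    using assms(3) by (simp add: smooth_closure_def)
  have "\<exists>G. continuous_extension Q (partial_deriv i \<psi>) G" for i
  proof -
    have "\<exists>G. continuous_extension Q (iter_partial_deriv [i] \<psi>) G"
      using assms(3) unfolding smooth_closure_def by blast
    then show ?thesis by simp
  qed
  then obtain G where G: "\<And>i. continuous_extension Q (partial_deriv i \<psi>) (G i)"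
    by metis
  have per: "\<psi> (clamp_Q (upd i x (- pi))) = \<psi> (clamp_Q (upd i x pi))" if "x \<in> Q" for i x
  proof -
    \<comment> \<open>Being continuous up to the boundary, \<psi> is its own extension, so the empty
      list of directions yields its periodicity.\<close>
    have "continuous_extension Q (iter_partial_deriv [] \<psi>) \<psi>"
      using c\<psi> by (simp add: continuous_extension_def)
    then have "periodic_Q \<psi>"
      using assms(4) unfolding all_derivs_periodic_def by blast
    moreover have "x \<in> closure Q" using that closure_subset[of Q] by auto
    ultimately have "\<psi> (upd i x (- pi)) = \<psi> (upd i x pi)"
      unfolding periodic_Q_def upd_def by blast
    moreover have "upd i x (- pi) \<in> closure Q" "upd i x pi \<in> closure Q"
      using that by (auto simp: mem_Q_iff mem_closure_Q_iff less_imp_le)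
    ultimately show ?thesis by (simp add: clamp_Q_id)
  qed
  \<comment> \<open>\<open>L\<close> will be \<open>Re\<close> and \<open>Im\<close>. Both squared
    moduli split into the squares of these two parts, so the real inequality is applied twice and
    added.\<close>
  define part where "part L = (\<lambda>x. L (\<psi> (clamp_Q x)) :: real)" for L
  define gpart where "gpart L = (\<lambda>i x. L (G i (clamp_Q x)) :: real)" for L
  have C1: "cube_C1 (part L) (gpart L)" if L: "bounded_linear L" for L
    unfolding cube_C1_def part_def gpart_def
  proof (intro conjI allI ballI)
    show "continuous_on UNIV (\<lambda>x. L (\<psi> (clamp_Q x)))"
      using linear_continuous_on[OF L] by (intro continuous_on_compose2[OF _ continuous_on_clamp_Q[OF c\<psi>]]) auto
    show "continuous_on UNIV (\<lambda>x. L (G i (clamp_Q x)))" for i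
      using linear_continuous_on[OF L] G
      by (intro continuous_on_compose2[OF _ continuous_on_clamp_Q]) (auto simp: continuous_extension_def)
    show "((\<lambda>t. L (\<psi> (clamp_Q (upd i x t)))) has_real_derivative L (G i (clamp_Q (upd i x t)))) (at t)"
      if "x \<in> Q" "t \<in> {- pi<..<pi}" for i x t
      using bounded_linear.has_vector_derivative[OF L has_vector_derivative_clamp_Q[OF assms(3) G]] that
      by (simp add: has_real_derivative_iff_has_vector_derivative)
  qed
  \<comment> \<open>Integrability is what permits \<open>L\<close> to be exchanged with the
    integral, so that both parts inherit the zero average.\<close>
  have int\<psi>: "integrable cube \<psi>"
  proof -
    have "integrable lborel (\<lambda>x. indicator (closure Q) x *\<^sub>R \<psi> x)"
      by (intro borel_integrable_compact c\<psi>) (simp add: closure_Q)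
    then have "set_integrable lborel (closure Q) \<psi>" by (simp add: set_integrable_def)
    then have "set_integrable lborel Q \<psi>"
      by (rule set_integrable_subset) (use closure_subset[of Q] in auto)
    then show ?thesis
      by (subst integrable_restrict_space) (auto simp: set_integrable_def)
  qed
  have mean: "(LINT x|cube. part L x) = 0" if L: "bounded_linear L" for L
  proof -
    have "(LINT x|cube. part L x) = (LINT x|cube. L (\<psi> x))"
      by (intro Bochner_Integration.integral_cong) (auto simp: part_def clamp_Q_Q)
    also have "\<dots> = L (LINT x|cube. \<psi> x)"
      by (rule integral_bounded_linear[OF L int\<psi>])
    also have "\<dots> = 0"
      using assms(5) linear_0[OF bounded_linear.linear[OF L]] by (simp add: integral_cube)
    finally show ?thesis .
  qed
  have main: "wint 0 (Suc n) (\<lambda>x. (part L x)\<^sup>2) \<le> inverse (H k CARD('n)) * wint 0 n (\<lambda>x. \<Sum>i\<in>UNIV. (gpart L i x)\<^sup>2)"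
    if L: "bounded_linear L" for L
    unfolding k by (rule weighted_hardy[OF C1[OF L] _ mean[OF L] n]) (simp add: part_def per)
  have c: "continuous_on UNIV (\<lambda>x. (part L x)\<^sup>2)" "continuous_on UNIV (\<lambda>x. \<Sum>i\<in>UNIV. (gpart L i x)\<^sup>2)"
    if "bounded_linear L" for L
    using C1[OF that] by (auto simp: cube_C1_def intro!: continuous_intros)
  note bl = bounded_linear_Re bounded_linear_Im
  have A: "(LINT x:Q|lborel. (cmod (\<psi> x))\<^sup>2 * \<omega> x powi (k - 1))
      = wint 0 (Suc n) (\<lambda>x. (part Re x)\<^sup>2) + wint 0 (Suc n) (\<lambda>x. (part Im x)\<^sup>2)"
  proof -
    have "(LINT x:Q|lborel. (cmod (\<psi> x))\<^sup>2 * \<omega> x powi (k - 1))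
        = (LINT x|cube. (part Re x)\<^sup>2 / \<omega> x ^ Suc n + (part Im x)\<^sup>2 / \<omega> x ^ Suc n)"
      unfolding integral_cube[symmetric]
    proof (intro Bochner_Integration.integral_cong refl)
      fix x :: "real^'n" assume "x \<in> space cube"
      moreover have "k - 1 = - int (Suc n)" by (simp add: k)
      ultimately show "(cmod (\<psi> x))\<^sup>2 * \<omega> x powi (k - 1) = (part Re x)\<^sup>2 / \<omega> x ^ Suc n + (part Im x)\<^sup>2 / \<omega> x ^ Suc n"
        by (simp only: omega_powi space_cube part_def clamp_Q_Q cmod_power2 add_divide_distrib)
    qed
    also have "\<dots> = wint 0 (Suc n) (\<lambda>x. (part Re x)\<^sup>2) + wint 0 (Suc n) (\<lambda>x. (part Im x)\<^sup>2)"
      unfolding wint_0 by (intro Bochner_Integration.integral_add integrable_weighted c bl n)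
    finally show ?thesis .
  qed
  have B: "(LINT x:Q|lborel. grad_norm_sq \<psi> x * \<omega> x powi k)
      = wint 0 n (\<lambda>x. \<Sum>i\<in>UNIV. (gpart Re i x)\<^sup>2) + wint 0 n (\<lambda>x. \<Sum>i\<in>UNIV. (gpart Im i x)\<^sup>2)"
  proof -
    have "(LINT x:Q|lborel. grad_norm_sq \<psi> x * \<omega> x powi k)
        = (LINT x|cube. (\<Sum>i\<in>UNIV. (gpart Re i x)\<^sup>2) / \<omega> x ^ n + (\<Sum>i\<in>UNIV. (gpart Im i x)\<^sup>2) / \<omega> x ^ n)"
      unfolding integral_cube[symmetric]
    proof (intro Bochner_Integration.integral_cong refl)
      fix x :: "real^'n" assume x: "x \<in> space cube"
      have "partial_deriv i \<psi> x = G i x" for i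
        using G x by (auto simp: continuous_extension_def)
      then have "grad_norm_sq \<psi> x = (\<Sum>i\<in>UNIV. (gpart Re i x)\<^sup>2) + (\<Sum>i\<in>UNIV. (gpart Im i x)\<^sup>2)"
        using x by (simp add: grad_norm_sq_def gpart_def clamp_Q_Q cmod_power2 sum.distrib)
      then show "grad_norm_sq \<psi> x * \<omega> x powi k
        = (\<Sum>i\<in>UNIV. (gpart Re i x)\<^sup>2) / \<omega> x ^ n + (\<Sum>i\<in>UNIV. (gpart Im i x)\<^sup>2) / \<omega> x ^ n"
        using x unfolding k by (simp only: omega_powi space_cube add_divide_distrib)
    qed
    also have "\<dots> = wint 0 n (\<lambda>x. \<Sum>i\<in>UNIV. (gpart Re i x)\<^sup>2) + wint 0 n (\<lambda>x. \<Sum>i\<in>UNIV. (gpart Im i x)\<^sup>2)"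
      unfolding wint_0 by (intro Bochner_Integration.integral_add integrable_weighted c bl n')
    finally show ?thesis .
  qed
  have H: "0 < H k CARD('n)"
    using inverse_H_pos[OF n] by (simp add: k)
  have "(LINT x:Q|lborel. (cmod (\<psi> x))\<^sup>2 * \<omega> x powi (k - 1))
      \<le> inverse (H k CARD('n)) * (LINT x:Q|lborel. grad_norm_sq \<psi> x * \<omega> x powi k)"
    unfolding A B using main[OF bounded_linear_Re] main[OF bounded_linear_Im] by (simp add: algebra_simps)
  then show ?thesis
    using H by (simp add: field_simps)
qed

end
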